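(* Let $0<L<\infty$ and let $\Gamma:S_L\to\mathbb{R}^n$ be a closed arclength parametrized curve of length $L$ with $\Gamma(s)=\Gamma(t)$ for some $s\neq t$, $s,t\in S_L$. If there is a sequence of rectifiable closed injective curves $\gamma_k:S_L\to\mathbb{R}^n$ converging uniformly to $\Gamma$, then $\mathcal{E}_q(\gamma_k)\to\infty$ as $k\to\infty$ for any $q>2$.
   Context: $S_L\cong\mathbb{R}/(L\mathbb{Z})$ is the circle of perimeter $L$. An arclength parametrized closed curve of length $L$ is a Lipschitz map $\Gamma:S_L\to\mathbb{R}^n$ with $|\Gamma'|=1$ a.e. For $s\in S_L$ and almost every $t\in S_L$ (those where $\Gamma'(t)$ exists with $|\Gamma'(t)|=1$) let $\ell(t)=\{\Gamma(t)+\mu\Gamma'(t):\mu\in\mathbb{R}\}$ be the tangent line, and define the tangent-point radius $$r(\Gamma(t),\Gamma(s))=\frac{|\Gamma(t)-\Gamma(s)|^2}{2\operatorname{dist}(\ell(t),\Gamma(s))}\in[0,\infty],$$ where $r$ is set to be $0$ if $\Gamma(t)=\Gamma(s)$, and $r=\infty$ (i.e. $1/r=0$) if $\Gamma(s)-\Gamma(t)\neq0$ is parallel to $\Gamma'(t)$. The tangent-point energy is $$\mathcal{E}_q(\Gamma)=\int_0^L\int_0^L\frac{ds\,dt}{r(\Gamma(t),\Gamma(s))^q}\in[0,\infty].$$ For a rectifiable closed injective (continuous) curve $\gamma_k:S_L\to\mathbb{R}^n$ of length $L_k$, $\mathcal{E}_q(\gamma_k)$ means $\mathcal{E}_q(\Gamma_k)$,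 where $\Gamma_k:S_{L_k}\to\mathbb{R}^n$ is its injective arclength parametrization. *)

theory Defs
  imports "HOL-Analysis.Analysis" "HOL-Library.Real_Mod"
begin

text \<open>
  A map on the circle of perimeter \<open>L\<close> is represented by an \<open>L\<close>-periodic map on the real line;
  \<open>{0..<L}\<close> is a set of representatives of the points of the circle. In this representation
  Lipschitz continuity, continuity and uniform convergence on the circle are the same as the
  corresponding notions on the whole line.
\<close>

definition periodic_map :: "real \<Rightarrow> (real \<Rightarrow> 'a) \<Rightarrow> bool" where
  "periodic_map L f \<longleftrightarrow> (\<forall>t. f (t + L) = f t)"

definition closed_curve :: "real \<Rightarrow> (real \<Rightarrow> real ^ 'n) \<Rightarrow> bool" where
  "closed_curve L \<gamma> \<longleftrightarrow> periodic_map L \<gamma> \<and> continuous_on UNIV \<gamma>"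

definition injective_closed_curve :: "real \<Rightarrow> (real \<Rightarrow> real ^ 'n) \<Rightarrow> bool" where
  "injective_closed_curve L \<gamma> \<longleftrightarrow> closed_curve L \<gamma> \<and> inj_on \<gamma> {0..<L}"

definition tangent_pts :: "(real \<Rightarrow> real ^ 'n) \<Rightarrow> real set" where
  "tangent_pts \<Gamma> =
     {t. \<Gamma> differentiable (at t) \<and> norm (vector_derivative \<Gamma> (at t)) = 1}"

definition closed_arclength_curve :: "real \<Rightarrow> (real \<Rightarrow> real ^ 'n) \<Rightarrow> bool" where
  "closed_arclength_curve L \<Gamma> \<longleftrightarrow>
     periodic_map L \<Gamma> \<and> (\<exists>C. C-lipschitz_on UNIV \<Gamma>) \<and> (AE t in lborel. t \<in> tangent_pts \<Gamma>)"

subsection \<open>Length and arclength parametrization\<close>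

text \<open>
  Length of \<open>\<gamma>\<close> on \<open>{a..b}\<close>: supremum of the lengths of inscribed polygons with vertices at
  parameters \<open>\<tau> 0 \<le> \<dots> \<le> \<tau> N\<close> in \<open>{a..b}\<close>.
\<close>

definition curve_length :: "(real \<Rightarrow> real ^ 'n) \<Rightarrow> real \<Rightarrow> real \<Rightarrow> ennreal" where
  "curve_length \<gamma> a b =
     (SUP (N, \<tau>) \<in> {(N :: nat, \<tau> :: nat \<Rightarrow> real). mono \<tau> \<and> range \<tau> \<subseteq> {a..b}}.
        \<Sum>i<N. ennreal (dist (\<gamma> (\<tau> i)) (\<gamma> (\<tau> (Suc i)))))"

definition rectifiable_closed_curve :: "real \<Rightarrow> (real \<Rightarrow> real ^ 'n) \<Rightarrow> bool" where
  "rectifiable_closed_curve L \<gamma> \<longleftrightarrow> closed_curve L \<gamma> \<and> curve_length \<gamma> 0 L < \<infinity>"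

definition total_length :: "real \<Rightarrow> (real \<Rightarrow> real ^ 'n) \<Rightarrow> real" where
  "total_length L \<gamma> = enn2real (curve_length \<gamma> 0 L)"

text \<open>
  The arclength parametrization sends \<open>\<sigma>\<close> in \<open>{0..<total_length L \<gamma>}\<close> to the point of \<open>\<gamma>\<close> whose
  arclength distance from \<open>\<gamma> 0\<close> along \<open>\<gamma>\<close> is \<open>\<sigma>\<close>, and is extended periodically. For a
  rectifiable injective closed curve the arclength is strictly increasing on \<open>{0..<L}\<close>, with
  image \<open>{0..<total_length L \<gamma>}\<close>, so the parameter \<open>t\<close> below exists and is unique.
\<close>

definition arclength_parametrization ::
    "real \<Rightarrow> (real \<Rightarrow> real ^ 'n) \<Rightarrow> real \<Rightarrow> real ^ 'n" where
  "arclength_parametrization L \<gamma> \<sigma> =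
     \<gamma> (THE t. t \<in> {0..<L} \<and> curve_length \<gamma> 0 t = ennreal (\<sigma> rmod total_length L \<gamma>))"

subsection \<open>Tangent-point energy\<close>

definition tangent_line :: "(real \<Rightarrow> real ^ 'n) \<Rightarrow> real \<Rightarrow> (real ^ 'n) set" where
  "tangent_line \<Gamma> t = {\<Gamma> t + \<mu> *\<^sub>R vector_derivative \<Gamma> (at t) | \<mu>. True}"

text \<open>
  For \<open>t \<in> tangent_pts \<Gamma>\<close> the second case says that \<open>\<Gamma> s - \<Gamma> t\<close> is parallel to the tangent.
\<close>

definition tp_radius :: "(real \<Rightarrow> real ^ 'n) \<Rightarrow> real \<Rightarrow> real \<Rightarrow> ennreal" where
  "tp_radius \<Gamma> t s =
     (if \<Gamma> t = \<Gamma> s then 0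
      else if \<Gamma> s \<in> tangent_line \<Gamma> t then \<infinity>
      else ennreal ((norm (\<Gamma> t - \<Gamma> s))\<^sup>2 / (2 * infdist (\<Gamma> s) (tangent_line \<Gamma> t))))"

text \<open>\<open>1 / r ^ q\<close> for \<open>r \<in> [0,\<infinity>]\<close> and real \<open>q > 0\<close>.\<close>

definition inverse_power :: "real \<Rightarrow> ennreal \<Rightarrow> ennreal" where
  "inverse_power q r =
     (if r = 0 then \<infinity> else if r = \<infinity> then 0 else ennreal (1 / enn2real r powr q))"

text \<open>
  The integrand is defined only for almost every \<open>t\<close>, hence the restriction to \<open>tangent_pts \<Gamma>\<close>.
\<close>

definition tp_energy :: "real \<Rightarrow> real \<Rightarrow> (real \<Rightarrow> real ^ 'n) \<Rightarrow> ennreal" where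
  "tp_energy q L \<Gamma> =
     (\<integral>\<^sup>+ t \<in> {0..L} \<inter> tangent_pts \<Gamma>.
        (\<integral>\<^sup>+ s \<in> {0..L}. inverse_power q (tp_radius \<Gamma> t s) \<partial>lborel) \<partial>lborel)"

definition tp_energy_of_curve :: "real \<Rightarrow> real \<Rightarrow> (real \<Rightarrow> real ^ 'n) \<Rightarrow> ennreal" where
  "tp_energy_of_curve q L \<gamma> = tp_energy q (total_length L \<gamma>) (arclength_parametrization L \<gamma>)"

end

theory Submission
  imports Defs
begin

text \<open>
  Suppose that a closed injective curve has tangent-point energy at most \<open>M\<close>, and that both arcs
  between its points \<open>\<gamma> s\<close> and \<open>\<gamma> t\<close> leave the ball of radius \<open>d\<close> around \<open>\<gamma> s\<close>. The claim is
  that \<open>norm (\<gamma> t - \<gamma> s)\<close> is bounded below by a constant that depends only on \<open>M\<close>, \<open>q\<close> and \<open>d\<close>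
  (\<open>energy_separation\<close>). The theorem follows: the limit curve \<open>\<Gamma>\<close> is not constant on any interval, so
  both arcs between the two parameters of a double point contain points away from it, and this
  survives a uniformly small perturbation, whereas the distance of the two strands tends to \<open>0\<close>.

  Let \<open>X\<close> be the image of the curve. Take points \<open>y\<close>, \<open>z\<close>, \<open>w\<close> of \<open>X\<close> such that \<open>z\<close> and \<open>w\<close> lie
  at comparable distances about \<open>D\<close> from \<open>y\<close>. Place parameter windows of length
  \<open>W = D powr (1 + \<beta>)\<close> at the three points. Since the energy over the windows is at most \<open>M\<close>,
  some tangent line based in the window at \<open>y\<close> passes close to the window at \<open>z\<close> and also to the
  one at \<open>w\<close>, within a distance of order \<open>D\<^sup>2 * (M / W\<^sup>2) powr (1 / q)\<close>. For
  \<open>\<beta> = (q - 2) / (q + 2)\<close>, which is positive exactly because \<open>q > 2\<close>, this is again of order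
  \<open>W\<close>. Hence the directions of \<open>z - y\<close> and \<open>w - y\<close> differ, up to sign, by at most
  \<open>C * D powr \<beta>\<close> (\<open>energy_flatness\<close>). These errors form a geometric series over dyadic scales
  (\<open>axis_dist_chain\<close>), so that in a ball of radius \<open>\<rho>\<close>, with \<open>\<rho>\<close> depending on \<open>M\<close>, \<open>q\<close> and
  \<open>d\<close>, all chords of \<open>X\<close> make an angle of at most 60 degrees with the line spanned by a single vector
  \<open>u\<close> (\<open>lipschitz_graph\<close>). The projection to \<open>u\<close> is then injective on the part of \<open>X\<close> in that ball. The strand through the
  centre crosses the ball and its projection covers a whole interval, so an injective curve has no
  room for a second strand near the centre (\<open>strands_apart\<close>).

  The energy integrates over the tangent points of the arclength parametrization, so the argument
  needs that almost every parameter is one (\<open>AE_tangent_pts\<close>). This is proved directly from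
  the fact that inscribed polygons exhaust the length: where a polygon is almost as long as the
  curve, the curve is almost straight, and a rising sun estimate turns the small total length
  defect into a small exceptional set.
\<close>

section \<open>Arclength\<close>

definition chord_sum :: "(real \<Rightarrow> real ^ 'n) \<Rightarrow> (nat \<Rightarrow> real) \<Rightarrow> nat \<Rightarrow> real" where
  "chord_sum \<gamma> \<tau> N = (\<Sum>i<N. dist (\<gamma> (\<tau> i)) (\<gamma> (\<tau> (Suc i))))"

lemma chord_sum_nonneg: "0 \<le> chord_sum \<gamma> \<tau> N"
  by (simp add: chord_sum_def sum_nonneg)

lemma curve_length_alt:
  "curve_length \<gamma> a b =
     (SUP (N, \<tau>) \<in> {(N, \<tau>). mono \<tau> \<and> range \<tau> \<subseteq> {a..b}}. ennreal (chord_sum \<gamma> \<tau> N))"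
  unfolding curve_length_def chord_sum_def by (simp add: sum_ennreal)

lemma chord_sum_le_curve_length:
  assumes "mono \<tau>" "range \<tau> \<subseteq> {a..b}"
  shows "ennreal (chord_sum \<gamma> \<tau> N) \<le> curve_length \<gamma> a b"
  unfolding curve_length_alt
  by (rule SUP_upper2[of "(N, \<tau>)"]) (use assms in auto)

lemma curve_length_leI:
  assumes "\<And>N (\<tau> :: nat \<Rightarrow> real). mono \<tau> \<Longrightarrow> range \<tau> \<subseteq> {a..b} \<Longrightarrow> ennreal (chord_sum \<gamma> \<tau> N) \<le> C"
  shows "curve_length \<gamma> a b \<le> C"
  unfolding curve_length_alt by (rule SUP_least) (use assms in auto)

lemma curve_length_mono:
  assumes "a' \<le> a" "b \<le> b'"
  shows "curve_length \<gamma> a b \<le> curve_length \<gamma> a' b'"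
proof (rule curve_length_leI)
  fix N and \<tau> :: "nat \<Rightarrow> real" assume "mono \<tau>" "range \<tau> \<subseteq> {a..b}"
  moreover from this assms have "range \<tau> \<subseteq> {a'..b'}" by fastforce
  ultimately show "ennreal (chord_sum \<gamma> \<tau> N) \<le> curve_length \<gamma> a' b'"
    by (intro chord_sum_le_curve_length)
qed

lemma dist_le_curve_length:
  assumes "a \<le> b"
  shows "ennreal (dist (\<gamma> a) (\<gamma> b)) \<le> curve_length \<gamma> a b"
proof -
  have "ennreal (chord_sum \<gamma> (\<lambda>i. if i = 0 then a else b) 1) \<le> curve_length \<gamma> a b"
    by (rule chord_sum_le_curve_length) (use assms in \<open>auto simp: mono_def\<close>)
  then show ?thesis by (simp add: chord_sum_def)
qed

text \<open>
  Clamping the vertices to the two sides of \<open>b\<close> inserts \<open>b\<close> as a vertex, without any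
  bookkeeping about where \<open>b\<close> lies among the vertices.
\<close>

lemma chord_sum_split:
  assumes "mono \<tau>"
  shows "chord_sum \<gamma> \<tau> N \<le> chord_sum \<gamma> (\<lambda>i. min (\<tau> i) b) N + chord_sum \<gamma> (\<lambda>i. max (\<tau> i) b) N"
  unfolding chord_sum_def sum.distrib[symmetric]
proof (rule sum_mono)
  fix i
  have "\<tau> i \<le> \<tau> (Suc i)" using assms by (simp add: mono_def)
  then consider "\<tau> (Suc i) \<le> b" | "b \<le> \<tau> i" | "\<tau> i \<le> b" "b \<le> \<tau> (Suc i)" by linarith
  then show "dist (\<gamma> (\<tau> i)) (\<gamma> (\<tau> (Suc i))) \<le>
     dist (\<gamma> (min (\<tau> i) b)) (\<gamma> (min (\<tau> (Suc i)) b)) + dist (\<gamma> (max (\<tau> i) b)) (\<gamma> (max (\<tau> (Suc i)) b))"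
    by cases (use \<open>\<tau> i \<le> \<tau> (Suc i)\<close> in \<open>auto simp: min_def max_def dist_triangle\<close>)
qed

text \<open>
  Two polygons, one in \<open>{a..b}\<close> and one in \<open>{b..c}\<close>, are joined into one; the chord between the
  last vertex of the first and the first vertex of the second can only increase the sum.
\<close>

lemma curve_length_superadditive:
  assumes "a \<le> b" "b \<le> c"
  shows "curve_length \<gamma> a b + curve_length \<gamma> b c \<le> curve_length \<gamma> a c"
proof -
  define P where "P = (\<lambda>a b. {(N::nat, \<tau>::nat \<Rightarrow> real). mono \<tau> \<and> range \<tau> \<subseteq> {a..b}})"
  have ne: "P a b \<noteq> {}" if "a \<le> b" for a b
  proof -
    have "(0, \<lambda>_. a) \<in> P a b" using that by (auto simp: P_def mono_def)
    then show ?thesis by blast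
  qed
  have "ennreal (chord_sum \<gamma> \<tau> N) + ennreal (chord_sum \<gamma> \<tau>' N') \<le> curve_length \<gamma> a c"
    if "(N, \<tau>) \<in> P a b" "(N', \<tau>') \<in> P b c" for N \<tau> N' \<tau>'
  proof -
    define \<sigma> where "\<sigma> = (\<lambda>i. if i \<le> N then \<tau> i else \<tau>' (i - Suc N))"
    have m: "mono \<tau>" "mono \<tau>'" and r: "\<And>i. a \<le> \<tau> i" "\<And>i. \<tau> i \<le> b" "\<And>i. b \<le> \<tau>' i" "\<And>i. \<tau>' i \<le> c"
      using that by (auto simp: P_def image_subset_iff)
    have "mono \<sigma>"
    proof (rule monoI)
      fix i j :: nat assume "i \<le> j"
      then show "\<sigma> i \<le> \<sigma> j"
        using m r order_trans[OF r(2)[of i] r(3)[of "j - Suc N"]]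
        by (auto simp: \<sigma>_def mono_def)
    qed
    moreover have "range \<sigma> \<subseteq> {a..c}"
      using r order_trans[OF r(2) assms(2)] order_trans[OF assms(1) r(3)] by (auto simp: \<sigma>_def)
    ultimately have le: "ennreal (chord_sum \<gamma> \<sigma> (Suc N + N')) \<le> curve_length \<gamma> a c"
      by (rule chord_sum_le_curve_length)
    have split: "(\<Sum>i<m + n. h i) = (\<Sum>i<m. h i) + (\<Sum>i<n. h (m + i))" for h :: "nat \<Rightarrow> real" and m n
      by (induction n) (auto simp: algebra_simps)
    have "chord_sum \<gamma> \<sigma> (Suc N + N') = (\<Sum>i<Suc N. dist (\<gamma> (\<sigma> i)) (\<gamma> (\<sigma> (Suc i)))) +
        (\<Sum>i<N'. dist (\<gamma> (\<sigma> (Suc N + i))) (\<gamma> (\<sigma> (Suc (Suc N + i)))))"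
      unfolding chord_sum_def split by simp
    also have "\<dots> \<ge> chord_sum \<gamma> \<tau> N + chord_sum \<gamma> \<tau>' N'"
      by (simp add: chord_sum_def \<sigma>_def)
    finally have "chord_sum \<gamma> \<tau> N + chord_sum \<gamma> \<tau>' N' \<le> chord_sum \<gamma> \<sigma> (Suc N + N')" .
    then have "ennreal (chord_sum \<gamma> \<tau> N) + ennreal (chord_sum \<gamma> \<tau>' N') \<le> ennreal (chord_sum \<gamma> \<sigma> (Suc N + N'))"
      by (simp add: ennreal_plus[symmetric] chord_sum_nonneg ennreal_leI del: ennreal_plus)
    with le show ?thesis by (rule order_trans[rotated])
  qed
  then have "(SUP p\<in>P a b. ennreal (chord_sum \<gamma> (snd p) (fst p))) + (SUP p\<in>P b c. ennreal (chord_sum \<gamma> (snd p) (fst p))) \<le> curve_length \<gamma> a c"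
    unfolding ennreal_SUP_add_left[OF ne[OF assms(1)], symmetric]
      ennreal_SUP_add_right[OF ne[OF assms(2)]]
    by (auto intro!: SUP_least)
  then show ?thesis
    by (simp add: curve_length_alt P_def case_prod_unfold)
qed

lemma curve_length_subadditive:
  assumes "a \<le> b" "b \<le> c"
  shows "curve_length \<gamma> a c \<le> curve_length \<gamma> a b + curve_length \<gamma> b c"
proof (rule curve_length_leI)
  fix N and \<tau> :: "nat \<Rightarrow> real" assume \<tau>: "mono \<tau>" "range \<tau> \<subseteq> {a..c}"
  have "ennreal (chord_sum \<gamma> (\<lambda>i. min (\<tau> i) b) N) \<le> curve_length \<gamma> a b"
    by (rule chord_sum_le_curve_length) (use \<tau> assms in \<open>auto simp: mono_def image_subset_iff min.coboundedI1\<close>)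
  moreover have "ennreal (chord_sum \<gamma> (\<lambda>i. max (\<tau> i) b) N) \<le> curve_length \<gamma> b c"
    by (rule chord_sum_le_curve_length) (use \<tau> assms in \<open>auto simp: mono_def image_subset_iff max.coboundedI1\<close>)
  moreover have "ennreal (chord_sum \<gamma> \<tau> N) \<le> ennreal (chord_sum \<gamma> (\<lambda>i. min (\<tau> i) b) N) + ennreal (chord_sum \<gamma> (\<lambda>i. max (\<tau> i) b) N)"
    using chord_sum_split[OF \<tau>(1), of \<gamma> N b]
    by (simp add: ennreal_plus[symmetric] chord_sum_nonneg ennreal_leI del: ennreal_plus)
  ultimately show "ennreal (chord_sum \<gamma> \<tau> N) \<le> curve_length \<gamma> a b + curve_length \<gamma> b c"
    by (meson add_mono order_trans)
qed

lemma curve_length_additive: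
  assumes "a \<le> b" "b \<le> c"
  shows "curve_length \<gamma> a c = curve_length \<gamma> a b + curve_length \<gamma> b c"
  using curve_length_superadditive[OF assms] curve_length_subadditive[OF assms] by (rule antisym[rotated])

lemma curve_length_same: "curve_length \<gamma> a a = 0"
proof -
  have "curve_length \<gamma> a a \<le> 0"
    by (rule curve_length_leI) (auto simp: chord_sum_def image_subset_iff)
  then show ?thesis by simp
qed

lemma curve_length_eq_arclength_diff:
  assumes fin: "curve_length \<gamma> 0 L < \<infinity>" and "0 \<le> s" "s \<le> t" "t \<le> L"
  defines "V \<equiv> \<lambda>t. enn2real (curve_length \<gamma> 0 t)"
  shows "curve_length \<gamma> s t = ennreal (V t - V s)" "V s \<le> V t"
proof -
  have t: "curve_length \<gamma> 0 t < \<infinity>"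
    using curve_length_mono[of 0 0 t L \<gamma>] fin assms by auto
  have add: "curve_length \<gamma> 0 t = curve_length \<gamma> 0 s + curve_length \<gamma> s t"
    using assms by (intro curve_length_additive) auto
  obtain x where x: "curve_length \<gamma> 0 s = ennreal x" "0 \<le> x"
    using t add by (cases "curve_length \<gamma> 0 s") auto
  obtain y where y: "curve_length \<gamma> s t = ennreal y" "0 \<le> y"
    using t add by (cases "curve_length \<gamma> s t") auto
  have "V s = x" "V t = x + y" using x y add by (auto simp: V_def simp flip: ennreal_plus)
  then show "curve_length \<gamma> s t = ennreal (V t - V s)" "V s \<le> V t" using y by auto
qed

lemma chord_sum_le_arclength_diff:
  assumes fin: "curve_length \<gamma> 0 L < \<infinity>" and "0 \<le> s" "s \<le> t" "t \<le> L"
    and \<tau>: "mono \<tau>" "range \<tau> \<subseteq> {s..t}"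
  defines "V \<equiv> \<lambda>t. enn2real (curve_length \<gamma> 0 t)"
  shows "chord_sum \<gamma> \<tau> N \<le> V t - V s"
  using chord_sum_le_curve_length[OF \<tau>, of \<gamma> N] curve_length_eq_arclength_diff[OF assms(1-4)]
  by (simp add: V_def)

lemma approx_curve_length:
  fixes \<gamma> :: "real \<Rightarrow> real ^ 'n"
  assumes fin: "curve_length \<gamma> a b < \<infinity>" and "a \<le> b" and "e > 0"
  shows "\<exists>N \<tau>. mono \<tau> \<and> range \<tau> \<subseteq> {a..b} \<and> enn2real (curve_length \<gamma> a b) - e < chord_sum \<gamma> \<tau> N"
proof (rule ccontr)
  define l where "l = enn2real (curve_length \<gamma> a b)"
  assume "\<not> ?thesis"
  then have no: "chord_sum \<gamma> \<tau> N \<le> l - e" if "mono \<tau>" "range \<tau> \<subseteq> {a..b}" for N and \<tau> :: "nat \<Rightarrow> real"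
    using that by (force simp: l_def not_less)
  have "0 \<le> l - e"
    using no[of "\<lambda>_. a" 0] \<open>a \<le> b\<close> by (auto simp: chord_sum_def mono_def)
  have "curve_length \<gamma> a b \<le> ennreal (l - e)"
    by (rule curve_length_leI) (use no in \<open>auto intro: ennreal_leI\<close>)
  then have "l \<le> l - e"
    using enn2real_mono[of "curve_length \<gamma> a b" "ennreal (l - e)"] \<open>0 \<le> l - e\<close> by (simp add: l_def)
  then show False using \<open>e > 0\<close> by simp
qed

text \<open>
  Fix a polygon with \<open>N\<close> edges that is longer than the curve minus \<open>e / 2\<close>. Clamping its vertices
  to \<open>{s..t}\<close> gives a polygon whose length misses that of the arc from \<open>s\<close> to \<open>t\<close> by less than
  \<open>e / 2\<close>, since the defects of the three pieces of the curve add up. The clamped polygon still has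
  \<open>N\<close> edges, and each becomes short with \<open>t - s\<close> by uniform continuity of \<open>\<gamma>\<close>.
\<close>

lemma continuous_on_arclength:
  fixes \<gamma> :: "real \<Rightarrow> real ^ 'n"
  assumes fin: "curve_length \<gamma> 0 L < \<infinity>" and "0 \<le> L" and cont: "continuous_on {0..L} \<gamma>"
  shows "continuous_on {0..L} (\<lambda>t. enn2real (curve_length \<gamma> 0 t))"
proof -
  define V where "V = (\<lambda>t. enn2real (curve_length \<gamma> 0 t))"
  have V_eq: "enn2real (curve_length \<gamma> 0 t) = V t" for t by (simp add: V_def)
  note V_le = chord_sum_le_arclength_diff[OF fin, unfolded V_eq]
  note V_diff = curve_length_eq_arclength_diff[OF fin, unfolded V_eq]
  have V0: "V 0 = 0" by (simp add: V_def curve_length_same)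
  have "\<exists>d>0. \<forall>x\<in>{0..L}. \<forall>y\<in>{0..L}. dist y x < d \<longrightarrow> dist (V y) (V x) < e" if "e > 0" for e
  proof -
    obtain N and \<tau> :: "nat \<Rightarrow> real" where \<tau>: "mono \<tau>" "range \<tau> \<subseteq> {0..L}" "V L - e / 2 < chord_sum \<gamma> \<tau> N"
      using approx_curve_length[OF fin \<open>0 \<le> L\<close>, of "e/2"] \<open>e > 0\<close> unfolding V_def by auto
    have clamp: "V t - V s < chord_sum \<gamma> (\<lambda>i. max (min (\<tau> i) t) s) N + e / 2"
      if st: "0 \<le> s" "s \<le> t" "t \<le> L" for s t
    proof -
      have "mono (\<lambda>i. min (\<tau> i) t)" using \<tau>(1) by (auto simp: mono_def min.coboundedI1)
      then have "chord_sum \<gamma> \<tau> N \<le> (chord_sum \<gamma> (\<lambda>i. min (min (\<tau> i) t) s) N +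
          chord_sum \<gamma> (\<lambda>i. max (min (\<tau> i) t) s) N) + chord_sum \<gamma> (\<lambda>i. max (\<tau> i) t) N"
        using chord_sum_split[OF \<tau>(1), of \<gamma> N t] chord_sum_split[of "\<lambda>i. min (\<tau> i) t" \<gamma> N s]
        by linarith
      moreover have "chord_sum \<gamma> (\<lambda>i. min (min (\<tau> i) t) s) N \<le> V s - V 0"
        by (rule V_le) (use \<tau> st in \<open>auto simp: mono_def image_subset_iff min.coboundedI1\<close>)
      moreover have "chord_sum \<gamma> (\<lambda>i. max (\<tau> i) t) N \<le> V L - V t"
        by (rule V_le) (use \<tau> st in \<open>auto simp: mono_def image_subset_iff max.coboundedI1\<close>)
      ultimately show ?thesis using \<tau>(3) V0 by linarith
    qed
    have "uniformly_continuous_on {0..L} \<gamma>"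
      using cont by (simp add: compact_uniformly_continuous)
    moreover have "e / (2 * (N + 1)) > 0" using \<open>e > 0\<close> by simp
    ultimately obtain d where d: "d > 0"
      "\<And>x y. x \<in> {0..L} \<Longrightarrow> y \<in> {0..L} \<Longrightarrow> dist y x < d \<Longrightarrow> dist (\<gamma> y) (\<gamma> x) < e / (2 * (N + 1))"
      unfolding uniformly_continuous_on_def by meson
    have le: "\<bar>V t - V s\<bar> < e" if st: "0 \<le> s" "s \<le> t" "t \<le> L" "t - s < d" for s t
    proof -
      have "chord_sum \<gamma> (\<lambda>i. max (min (\<tau> i) t) s) N \<le> (\<Sum>i<N. e / (2 * (N + 1)))"
        unfolding chord_sum_def
      proof (rule sum_mono)
        fix i
        show "dist (\<gamma> (max (min (\<tau> i) t) s)) (\<gamma> (max (min (\<tau> (Suc i)) t) s)) \<le> e / (2 * (N + 1))"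
          by (rule less_imp_le[OF d(2)]) (use st in \<open>auto simp: dist_real_def max_def min_def\<close>)
      qed
      also have "\<dots> \<le> e / 2" using \<open>e > 0\<close> by (simp add: field_simps)
      finally show ?thesis using clamp[OF st(1-3)] V_diff(2)[OF st(1-3)] by linarith
    qed
    show ?thesis
    proof (intro exI[of _ d] conjI ballI impI d(1))
      fix x y assume "x \<in> {0..L}" "y \<in> {0..L}" "dist y x < d"
      then show "dist (V y) (V x) < e"
        using le[of x y] le[of y x] by (cases "x \<le> y") (auto simp: dist_real_def abs_minus_commute)
    qed
  qed
  then have "uniformly_continuous_on {0..L} V" unfolding uniformly_continuous_on_def by blast
  then show ?thesis unfolding V_def by (rule uniformly_continuous_imp_continuous)
qed

text \<open>
  By injectivity the arclength \<open>V\<close> is strictly increasing, hence by continuity a bijection from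
  \<open>{0..L}\<close> to \<open>{0..l}\<close>, and the definite description yields \<open>f (V t) = \<gamma> t\<close>, also at \<open>t = L\<close>,
  where the wrap-around of \<open>rmod\<close> matches \<open>\<gamma> L = \<gamma> 0\<close>. The last property expresses
  that \<open>f\<close> restricted to \<open>{0..l}\<close> has length \<open>l\<close>.
\<close>

lemma arclength_parametrization_properties:
  fixes \<gamma> :: "real \<Rightarrow> real ^ 'n"
  assumes "0 < L" and rect: "rectifiable_closed_curve L \<gamma>" and inj: "injective_closed_curve L \<gamma>"
  defines "l \<equiv> total_length L \<gamma>" and "f \<equiv> arclength_parametrization L \<gamma>"
  shows "0 < l"
    and "\<And>x y. x \<in> {0..l} \<Longrightarrow> y \<in> {0..l} \<Longrightarrow> dist (f x) (f y) \<le> \<bar>x - y\<bar>"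
    and "f ` {0..l} = \<gamma> ` {0..L}"
    and "\<And>e. e > 0 \<Longrightarrow> \<exists>N p. mono p \<and> range p \<subseteq> {0..l} \<and> l - e < chord_sum f p N"
proof -
  have fin: "curve_length \<gamma> 0 L < \<infinity>" and cont: "continuous_on {0..L} \<gamma>" and per: "\<gamma> L = \<gamma> 0"
    and inj: "inj_on \<gamma> {0..<L}"
    using rect inj by (auto simp: rectifiable_closed_curve_def injective_closed_curve_def closed_curve_def
      periodic_map_def intro: continuous_on_subset dest: spec[of _ 0])
  define V where "V = (\<lambda>t. enn2real (curve_length \<gamma> 0 t))"
  have V_eq: "enn2real (curve_length \<gamma> 0 t) = V t" for t by (simp add: V_def)
  note V_diff = curve_length_eq_arclength_diff[OF fin, unfolded V_eq]
  have V0: "V 0 = 0" and VL: "V L = l" by (simp_all add: V_def curve_length_same l_def total_length_def)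
  have V_nonneg: "0 \<le> V t" for t by (simp add: V_def)
  have dist_le: "dist (\<gamma> s) (\<gamma> t) \<le> \<bar>V s - V t\<bar>" if "s \<in> {0..L}" "t \<in> {0..L}" for s t
  proof -
    have *: "dist (\<gamma> s) (\<gamma> t) \<le> V t - V s" if "0 \<le> s" "s \<le> t" "t \<le> L" for s t
      using dist_le_curve_length[OF that(2), of \<gamma>] V_diff[OF that] by (simp add: V_def)
    show ?thesis using *[of s t] *[of t s] that by (cases "s \<le> t") (auto simp: dist_commute)
  qed
  have strict: "V s < V t" if "0 \<le> s" "s < t" "t \<le> L" for s t
  proof -
    have "\<gamma> s \<noteq> \<gamma> ((s + t) / 2)" using inj_on_eq_iff[OF inj, of s "(s + t) / 2"] that by simp
    then have "0 < dist (\<gamma> s) (\<gamma> ((s + t) / 2))" by simp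
    also have "\<dots> \<le> \<bar>V s - V ((s + t) / 2)\<bar>" by (rule dist_le) (use that in auto)
    finally have "V s \<noteq> V ((s + t) / 2)" by simp
    moreover have "V s \<le> V ((s + t) / 2)" "V ((s + t) / 2) \<le> V t"
      by (rule V_diff(2); use that in simp)+
    ultimately show ?thesis by linarith
  qed
  show "0 < l" using strict[of 0 L] \<open>0 < L\<close> V0 VL by simp
  have V_img: "V ` {0..L} = {0..l}"
  proof
    show "V ` {0..L} \<subseteq> {0..l}"
    proof (rule image_subsetI)
      fix t assume "t \<in> {0..L}"
      then show "V t \<in> {0..l}" using V_diff(2)[of 0 t] V_diff(2)[of t L] V0 VL by simp
    qed
    show "{0..l} \<subseteq> V ` {0..L}"
    proof
      fix y assume "y \<in> {0..l}"
      moreover have "continuous_on {0..L} V"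
        using continuous_on_arclength[OF fin _ cont] \<open>0 < L\<close> by (simp add: V_def)
      ultimately show "y \<in> V ` {0..L}" using IVT'[of V 0 y L] \<open>0 < L\<close> V0 VL by auto
    qed
  qed
  have f_V: "f (V t) = \<gamma> t" if "t \<in> {0..L}" for t
  proof -
    define t' where "t' = (if t = L then 0 else t)"
    have t': "t' \<in> {0..<L}" "\<gamma> t' = \<gamma> t" using that \<open>0 < L\<close> per by (auto simp: t'_def)
    have "V t rmod l = V t'"
    proof (cases "t = L")
      case True
      then show ?thesis using \<open>0 < l\<close> by (simp add: t'_def V0 VL rmod_unique[of 0 l l 1])
    next
      case False
      then have "V t < l" "0 \<le> V t" using that strict[of t L] VL by (auto simp: V_def)
      then show ?thesis using False by (simp add: t'_def rmod_unique[of _ l _ 0])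
    qed
    moreover have "curve_length \<gamma> 0 u = ennreal (V t') \<longleftrightarrow> u = t'" if "u \<in> {0..<L}" for u
    proof -
      have "curve_length \<gamma> 0 u = ennreal (V u)" using V_diff(1)[of 0 u] that V0 by simp
      then have "curve_length \<gamma> 0 u = ennreal (V t') \<longleftrightarrow> V u = V t'" by (simp add: V_nonneg)
      also have "\<dots> \<longleftrightarrow> u = t'" using strict[of u t'] strict[of t' u] that t' by fastforce
      finally show ?thesis .
    qed
    ultimately have "(THE u. u \<in> {0..<L} \<and> curve_length \<gamma> 0 u = ennreal (V t rmod l)) = t'"
      using t'(1) by (intro the_equality) auto
    then show ?thesis using t'(2) by (simp add: f_def arclength_parametrization_def l_def)
  qed
  show "dist (f x) (f y) \<le> \<bar>x - y\<bar>" if "x \<in> {0..l}" "y \<in> {0..l}" for x y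
    using that unfolding V_img[symmetric] by (auto simp: f_V dist_le)
  show "f ` {0..l} = \<gamma> ` {0..L}"
    unfolding V_img[symmetric] by (auto simp: f_V image_image)
  show "\<exists>N p. mono p \<and> range p \<subseteq> {0..l} \<and> l - e < chord_sum f p N" if e: "e > 0" for e
  proof -
    obtain N and \<tau> :: "nat \<Rightarrow> real" where \<tau>: "mono \<tau>" "range \<tau> \<subseteq> {0..L}" "l - e < chord_sum \<gamma> \<tau> N"
      using approx_curve_length[OF fin _ e] \<open>0 < L\<close> unfolding l_def total_length_def by auto
    have "mono (V \<circ> \<tau>)"
      using \<tau> by (intro monoI) (auto simp: image_subset_iff mono_def intro!: V_diff(2))
    moreover have "range (V \<circ> \<tau>) \<subseteq> {0..l}" using \<tau>(2) V_img by (auto simp flip: V_img)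
    moreover have "chord_sum f (V \<circ> \<tau>) N = chord_sum \<gamma> \<tau> N"
      using \<tau>(2) by (simp add: chord_sum_def f_V image_subset_iff)
    ultimately show ?thesis using \<tau>(3) by metis
  qed
qed

section \<open>Almost every parameter of an arclength parametrization is a tangent point\<close>

text \<open>
  The rising sun inequality, by real induction instead of a covering argument: the largest \<open>x\<close> for
  which the inequality holds with \<open>K \<inter> {a..x}\<close> and \<open>g x\<close> is \<open>b\<close>. From a point outside \<open>K\<close> one can
  proceed because \<open>K\<close> is closed, and from a point of \<open>K\<close> one can jump to the point \<open>s\<close> at which
  \<open>g\<close> has risen steeply.
\<close>

lemma compact_steep_measure:
  fixes g :: "real \<Rightarrow> real"
  assumes "a \<le> b" and cont: "continuous_on {a..b} g" and "mono_on {a..b} g"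
    and "compact K" and "K \<subseteq> {a..<b}"
    and steep: "\<And>t. t \<in> K \<Longrightarrow> \<exists>s\<in>{t<..b}. \<eta> * (s - t) < g s - g t"
  shows "\<eta> * measure lebesgue K \<le> g b - g a"
proof -
  define m where "m = (\<lambda>x. measure lebesgue (K \<inter> {a..x}))"
  have meas: "K \<inter> {x..y} \<in> lmeasurable" for x y
    using \<open>compact K\<close> by (simp add: lmeasurable_compact compact_Int_closed)
  have m_step: "m y \<le> m x + (y - x)" if "x \<le> y" for x y
  proof -
    have "m y \<le> measure lebesgue ((K \<inter> {a..x}) \<union> {x..y})"
      unfolding m_def by (rule measure_mono_fmeasurable) (use meas in auto)
    also have "\<dots> \<le> m x + measure lebesgue {x..y}"
      unfolding m_def by (rule measure_Un_le) (use meas in auto)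
    finally show ?thesis using that by simp
  qed
  have m_mono: "m x \<le> m y" if "x \<le> y" for x y
    unfolding m_def by (rule measure_mono_fmeasurable) (use meas that in auto)
  define S where "S = {x \<in> {a..b}. \<eta> * m x \<le> g x - g a}"
  have "m a = 0" 
    unfolding m_def by (intro negligible_imp_measure0 negligible_subset[OF negligible_sing[of a]]) auto
  then have "a \<in> S" using \<open>a \<le> b\<close> by (simp add: S_def)
  have "continuous_on {a..b} m"
  proof -
    have "dist (m x) (m y) \<le> 1 * dist x y" for x y
      using m_step[of x y] m_step[of y x] m_mono[of x y] m_mono[of y x]
      by (cases "x \<le> y") (auto simp: dist_real_def)
    then have "1-lipschitz_on {a..b} m" by (intro lipschitz_onI) auto
    then show ?thesis by (rule lipschitz_on_continuous_on)
  qed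
  then have "closed S"
    unfolding S_def using cont
    by (intro continuous_on_closed_Collect_le) (auto intro!: continuous_intros)
  then have "compact S"
    by (rule compact_eq_bounded_closed[THEN iffD2, OF conjI, rotated])
       (auto simp: S_def intro: bounded_subset[of "{a..b}"])
  then obtain x where "x \<in> S" and max: "\<And>y. y \<in> S \<Longrightarrow> y \<le> x"
    using compact_attains_sup[of S] \<open>a \<in> S\<close> by blast
  have "x = b"
  proof (rule ccontr)
    assume "x \<noteq> b"
    with \<open>x \<in> S\<close> have x: "a \<le> x" "x < b" "\<eta> * m x \<le> g x - g a" by (auto simp: S_def)
    show False
    proof (cases "x \<in> K")
      case True
      then obtain s where s: "x < s" "s \<le> b" "\<eta> * (s - x) < g s - g x" using steep by force
      show False
      proof (cases "\<eta> \<ge> 0")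
        case True
        then have "\<eta> * m s \<le> \<eta> * (m x + (s - x))"
          using m_step[of x s] s by (intro mult_left_mono) auto
        then have "s \<in> S" using s x by (auto simp: S_def algebra_simps)
        then show False using max[of s] s by simp
      next
        case False
        then have "\<eta> * m s \<le> \<eta> * m x" using m_mono[of x s] s by (intro mult_left_mono_neg) auto
        moreover have "g x \<le> g s" using \<open>mono_on _ g\<close> s x by (auto simp: mono_on_def)
        ultimately have "s \<in> S" using s x by (auto simp: S_def)
        then show False using max[of s] s by simp
      qed
    next
      case False
      then obtain e where e: "e > 0" "\<And>y. dist y x < e \<Longrightarrow> y \<notin> K"
        using \<open>compact K\<close> by (metis open_dist open_Compl compact_imp_closed Compl_iff)
      define y where "y = min b (x + e / 2)"
      have y: "x < y" "y \<le> b" using x e by (auto simp: y_def)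
      have "K \<inter> {a..y} = K \<inter> {a..x}"
        using e y by (force simp: y_def dist_real_def)
      then have "m y = m x" by (simp add: m_def)
      moreover have "g x \<le> g y" using \<open>mono_on _ g\<close> y x by (auto simp: mono_on_def)
      ultimately have "y \<in> S" using y x by (auto simp: S_def)
      then show False using max[of y] y by simp
    qed
  qed
  moreover have "K \<inter> {a..b} = K" using \<open>K \<subseteq> _\<close> by auto
  ultimately show ?thesis using \<open>x \<in> S\<close> by (simp add: S_def m_def)
qed

text \<open>
  The set of points that are the left end of a steep chord is open, so that it is exhausted by
  compact sets.
\<close>

lemma right_steep_measure:
  fixes g :: "real \<Rightarrow> real"
  assumes "a \<le> b" and cont: "continuous_on {a..b} g" and "mono_on {a..b} g" and "0 < \<eta>"
  defines "B \<equiv> {t \<in> {a<..<b}. \<exists>s\<in>{t<..<b}. \<eta> * (s - t) < g s - g t}"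
  shows "open B" and "measure lebesgue B \<le> (g b - g a) / \<eta>"
proof -
  have eq: "B = (\<Union>s\<in>{a<..<b}. {t \<in> {a<..<s}. \<eta> * (s - t) < g s - g t})"
    by (auto simp: B_def Bex_def) (metis less_trans)
  have "open {t \<in> {a<..<s}. \<eta> * (s - t) < g s - g t}" if "s \<in> {a<..<b}" for s
  proof -
    have "continuous_on {a<..<s} (\<lambda>t. (g s - g t) - \<eta> * (s - t))"
      by (intro continuous_intros continuous_on_subset[OF cont]) (use that in auto)
    then have "open ({a<..<s} \<inter> (\<lambda>t. (g s - g t) - \<eta> * (s - t)) -` {0<..})"
      by (intro continuous_open_preimage) auto
    moreover have "{a<..<s} \<inter> (\<lambda>t. (g s - g t) - \<eta> * (s - t)) -` {0<..} = {t \<in> {a<..<s}. \<eta> * (s - t) < g s - g t}"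
      by auto
    ultimately show ?thesis by simp
  qed
  then show "open B" unfolding eq by (intro open_UN) auto
  have "bounded B" by (rule bounded_subset[of "{a..b}"]) (auto simp: B_def)
  with \<open>open B\<close> have BM: "B \<in> lmeasurable" by (rule lmeasurable_open[rotated])
  show "measure lebesgue B \<le> (g b - g a) / \<eta>"
  proof (rule field_le_epsilon)
    fix e :: real assume "e > 0"
    then obtain K where K: "closed K" "K \<subseteq> B" "B - K \<in> lmeasurable" "emeasure lebesgue (B - K) < ennreal e"
      using sets_lebesgue_inner_closed[of B e] BM by (auto simp: fmeasurable_def)
    have "compact K" using K \<open>bounded B\<close> by (meson bounded_subset compact_eq_bounded_closed)
    have "\<eta> * measure lebesgue K \<le> g b - g a"
    proof (rule compact_steep_measure[OF assms(1-3) \<open>compact K\<close>])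
      show "K \<subseteq> {a..<b}" using K(2) by (auto simp: B_def)
      show "\<exists>s\<in>{t<..b}. \<eta> * (s - t) < g s - g t" if "t \<in> K" for t
      proof -
        have "t \<in> B" using that K(2) by blast
        then obtain s where "s \<in> {t<..<b}" "\<eta> * (s - t) < g s - g t" unfolding B_def by blast
        then show ?thesis by (intro bexI[of _ s]) auto
      qed
    qed
    then have "measure lebesgue K \<le> (g b - g a) / \<eta>" using \<open>0 < \<eta>\<close> by (simp add: field_simps)
    moreover have "measure lebesgue (B - K) < e"
      using K \<open>e > 0\<close> by (simp add: emeasure_eq_measure2 ennreal_less_iff)
    moreover have "measure lebesgue B \<le> measure lebesgue K + measure lebesgue (B - K)"
      using measure_Un_le[of K lebesgue "B - K"] K \<open>compact K\<close> 
      by (simp add: Un_absorb1 fmeasurableD lmeasurable_compact)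
    ultimately show "measure lebesgue B \<le> (g b - g a) / \<eta> + e" by linarith
  qed
qed

text \<open>
  Chords to the left are chords to the right of the reflected function \<open>\<lambda>x. - g (- x)\<close>.
\<close>

lemma steep_measure:
  fixes g :: "real \<Rightarrow> real"
  assumes "a \<le> b" and cont: "continuous_on {a..b} g" and mono: "mono_on {a..b} g" and "0 < \<eta>"
  obtains B where "B \<in> lmeasurable" "measure lebesgue B \<le> 2 * (g b - g a) / \<eta>"
    "\<And>s t. t \<in> {a<..<b} - B \<Longrightarrow> s \<in> {a<..<b} \<Longrightarrow> \<bar>g s - g t\<bar> \<le> \<eta> * \<bar>s - t\<bar>"
proof -
  define B1 where "B1 = {t \<in> {a<..<b}. \<exists>s\<in>{t<..<b}. \<eta> * (s - t) < g s - g t}"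
  define h where "h = (\<lambda>x. - g (- x))"
  define B2 where "B2 = {t \<in> {-b<..< -a}. \<exists>s\<in>{t<..< -a}. \<eta> * (s - t) < h s - h t}"
  have h: "continuous_on {-b..-a} h" "mono_on {-b..-a} h"
    unfolding h_def using mono
    by (auto intro!: continuous_intros continuous_on_compose2[OF cont] simp: mono_on_def)
  note 1 = right_steep_measure[OF assms, folded B1_def]
  note 2 = right_steep_measure[OF _ h \<open>0 < \<eta>\<close>, folded B2_def]
  have B1: "B1 \<in> lmeasurable"
    by (rule lmeasurable_open[OF _ 1(1)]) (auto simp: B1_def intro: bounded_subset[of "{a..b}"])
  have B2: "B2 \<in> lmeasurable"
    by (rule lmeasurable_open[OF _ 2(1)]) (use assms in \<open>auto simp: B2_def intro: bounded_subset[of "{-b..-a}"]\<close>)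
  have "uminus ` B2 \<in> lmeasurable"
  proof (rule lmeasurable_open[OF bounded_subset[of "{a..b}"]])
    show "open (uminus ` B2)" using 2(1) assms(1) by (intro open_negations) auto
  qed (auto simp: B2_def)
  moreover have "measure lebesgue (uminus ` B2) = measure lebesgue B2"
    using measure_lebesgue_affine[of "-1" 0 B2] by simp
  ultimately have B2m: "uminus ` B2 \<in> lmeasurable" "measure lebesgue (uminus ` B2) = measure lebesgue B2" .
  show thesis
  proof (rule that[of "B1 \<union> uminus ` B2"])
    show "B1 \<union> uminus ` B2 \<in> lmeasurable" using B1 B2m by auto
    have "measure lebesgue (B1 \<union> uminus ` B2) \<le> measure lebesgue B1 + measure lebesgue (uminus ` B2)"
      using B1 B2m by (intro measure_Un_le) auto
    also have "\<dots> \<le> (g b - g a) / \<eta> + (h (-a) - h (-b)) / \<eta>"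
      using 1(2) 2(2) assms(1) B2m by (intro add_mono) auto
    also have "\<dots> = 2 * (g b - g a) / \<eta>" by (simp add: h_def)
    finally show "measure lebesgue (B1 \<union> uminus ` B2) \<le> 2 * (g b - g a) / \<eta>" .
    fix s t assume t: "t \<in> {a<..<b} - (B1 \<union> uminus ` B2)" and s: "s \<in> {a<..<b}"
    consider "s = t" | "t < s" | "s < t" by linarith
    then show "\<bar>g s - g t\<bar> \<le> \<eta> * \<bar>s - t\<bar>"
    proof cases
      case 2
      then have "g t \<le> g s" using mono s t by (auto simp: mono_on_def)
      moreover have "\<not> \<eta> * (s - t) < g s - g t" using 2 s t by (auto simp: B1_def)
      ultimately show ?thesis using 2 by simp
    next
      case 3
      then have le: "g s \<le> g t" using mono s t by (auto simp: mono_on_def)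
      have "- t \<notin> B2" using t by (metis DiffD2 UnCI image_eqI minus_minus)
      moreover have "- s \<in> {- t<..<- a}" "- t \<in> {- b<..<- a}" using 3 s t by auto
      ultimately have "\<not> \<eta> * (- s - - t) < h (- s) - h (- t)" unfolding B2_def by blast
      with le show ?thesis using 3 by (simp add: h_def algebra_simps)
    qed simp
  qed
qed

text \<open>
  Let \<open>u\<close> be the direction of the chord from \<open>f a\<close> to \<open>f b\<close>. The function \<open>\<lambda>t. t - f t \<bullet> u\<close> is
  nondecreasing as \<open>f\<close> is 1-Lipschitz, and its total increment is the length defect
  \<open>(b - a) - dist (f a) (f b)\<close>. Where it has no steep chord, with slope bound \<open>\<eta>\<^sup>2 / 2\<close>, a
  difference quotient \<open>v\<close> of \<open>f\<close> satisfies \<open>norm v \<le> 1\<close> and \<open>v \<bullet> u \<ge> 1 - \<eta>\<^sup>2 / 2\<close>, and therefore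
  \<open>(norm (v - u))\<^sup>2 \<le> 1 - 2 * (v \<bullet> u) + 1 \<le> \<eta>\<^sup>2\<close>.
\<close>

lemma nearly_straight_cell:
  fixes f :: "real \<Rightarrow> real ^ 'n"
  assumes "a \<le> b" and lip: "\<And>s t. s \<in> {a..b} \<Longrightarrow> t \<in> {a..b} \<Longrightarrow> dist (f s) (f t) \<le> \<bar>s - t\<bar>"
    and "0 < \<eta>"
  shows "\<exists>u B. norm u = 1 \<and> B \<in> lmeasurable \<and>
    measure lebesgue B \<le> 4 * ((b - a) - dist (f a) (f b)) / \<eta>\<^sup>2 \<and>
    (\<forall>t\<in>{a<..<b} - B. \<forall>s\<in>{a<..<b}. norm (f s - f t - (s - t) *\<^sub>R u) \<le> \<eta> * \<bar>s - t\<bar>)"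
proof -
  obtain u :: "real ^ 'n" where u: "norm u = 1" "(f b - f a) \<bullet> u = dist (f a) (f b)"
  proof (cases "f a = f b")
    case True
    obtain u :: "real ^ 'n" where "norm u = 1" using vector_choose_size[of 1] by auto
    with True that show thesis by auto
  next
    case False
    then have "norm (sgn (f b - f a)) = 1" by (simp add: norm_sgn)
    moreover have *: "x \<bullet> sgn x = norm x" for x :: "real ^ 'n"
      by (cases "x = 0") (simp_all add: sgn_div_norm dot_square_norm power2_eq_square field_simps)
    have "(f b - f a) \<bullet> sgn (f b - f a) = dist (f a) (f b)"
      unfolding dist_norm norm_minus_commute[of "f a" "f b"] by (rule *)
    ultimately show thesis using that by blast
  qed
  define g where "g = (\<lambda>t. t - f t \<bullet> u)"
  have proj: "(f t - f s) \<bullet> u \<le> t - s" if "s \<in> {a..b}" "t \<in> {a..b}" "s \<le> t" for s t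
    using norm_cauchy_schwarz[of "f t - f s" u] u lip[of t s] that by (simp add: dist_norm)
  have mono: "mono_on {a..b} g"
    using proj by (force simp: mono_on_def g_def inner_diff_left)
  have "1-lipschitz_on {a..b} f" by (rule lipschitz_onI) (use lip in \<open>auto simp: dist_real_def\<close>)
  then have cont: "continuous_on {a..b} g"
    unfolding g_def by (intro continuous_intros lipschitz_on_continuous_on)
  have "0 < \<eta>\<^sup>2 / 2" using \<open>0 < \<eta>\<close> by simp
  then obtain B where B: "B \<in> lmeasurable" "measure lebesgue B \<le> 2 * (g b - g a) / (\<eta>\<^sup>2 / 2)"
    "\<And>s t. t \<in> {a<..<b} - B \<Longrightarrow> s \<in> {a<..<b} \<Longrightarrow> \<bar>g s - g t\<bar> \<le> \<eta>\<^sup>2 / 2 * \<bar>s - t\<bar>"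
    using steep_measure[OF \<open>a \<le> b\<close> cont mono] by blast
  have "norm (f s - f t - (s - t) *\<^sub>R u) \<le> \<eta> * \<bar>s - t\<bar>"
    if t: "t \<in> {a<..<b} - B" and s: "s \<in> {a<..<b}" for s t
  proof -
    define r where "r = s - t"
    define d where "d = f s - f t"
    have "r * r - r * (d \<bullet> u) = r * (g s - g t)"
      by (simp add: g_def r_def d_def inner_diff_left algebra_simps)
    also have "\<dots> \<le> \<bar>r\<bar> * \<bar>g s - g t\<bar>" by (metis abs_ge_self abs_mult)
    also have "\<dots> \<le> \<bar>r\<bar> * (\<eta>\<^sup>2 / 2 * \<bar>r\<bar>)" using B(3)[OF t s] by (intro mult_left_mono) (auto simp: r_def)
    also have "\<dots> = \<eta>\<^sup>2 / 2 * (\<bar>r\<bar> * \<bar>r\<bar>)" by (simp only: ac_simps)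
    also have "\<bar>r\<bar> * \<bar>r\<bar> = r\<^sup>2" by (simp add: power2_eq_square)
    finally have *: "r\<^sup>2 - r * (d \<bullet> u) \<le> \<eta>\<^sup>2 / 2 * r\<^sup>2" by (simp add: power2_eq_square)
    have "norm d \<le> \<bar>r\<bar>" using lip[of s t] s t by (simp add: r_def d_def dist_norm)
    then have "(norm d)\<^sup>2 \<le> r\<^sup>2" using abs_le_square_iff[of "norm d" r] by simp
    moreover have "(norm (d - r *\<^sub>R u))\<^sup>2 = (norm d)\<^sup>2 - 2 * (r * (d \<bullet> u)) + r\<^sup>2"
      using u(1) unfolding power2_norm_eq_inner norm_eq_1
      by (simp add: inner_diff_left inner_diff_right inner_commute[of u d] power2_eq_square algebra_simps)
    ultimately have "(norm (d - r *\<^sub>R u))\<^sup>2 \<le> (\<eta> * \<bar>r\<bar>)\<^sup>2"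
      using * by (simp add: power_mult_distrib)
    then have "norm (d - r *\<^sub>R u) \<le> \<eta> * \<bar>r\<bar>"
      by (rule power2_le_imp_le) (use \<open>0 < \<eta>\<close> in simp)
    then show ?thesis by (simp add: r_def d_def)
  qed
  moreover have "g b - g a = (b - a) - dist (f a) (f b)"
    using u(2) by (simp add: g_def inner_diff_left)
  ultimately show ?thesis using B(1,2) u(1) by (intro exI[of _ u] exI[of _ B]) simp
qed

lemma cell_exists:
  fixes p :: "nat \<Rightarrow> real"
  assumes "p 0 < t" "t < p N" "\<And>i. i \<le> N \<Longrightarrow> t \<noteq> p i"
  shows "\<exists>i<N. p i < t \<and> t < p (Suc i)"
  using assms
proof (induction N)
  case (Suc N)
  show ?case
  proof (cases "t < p N")
    case True
    then show ?thesis using Suc by (metis le_SucI less_SucI)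
  next
    case False
    then have "p N < t" using Suc.prems(3)[of N] by simp
    then show ?thesis using Suc.prems by blast
  qed
qed auto

definition nearly_straight_at :: "real \<Rightarrow> (real \<Rightarrow> real ^ 'n) \<Rightarrow> real \<Rightarrow> bool" where
  "nearly_straight_at \<eta> f t \<longleftrightarrow> (\<exists>u d. norm u = 1 \<and> d > 0 \<and>
     (\<forall>s. \<bar>s - t\<bar> < d \<longrightarrow> norm (f s - f t - (s - t) *\<^sub>R u) \<le> \<eta> * \<bar>s - t\<bar>))"

text \<open>
  Over the cells of an inscribed polygon that misses the length \<open>l\<close> by less than \<open>e\<close>, the length
  defects sum to less than \<open>e\<close>, so the exceptional sets of the cells have total measure at most
  \<open>4 * e / \<eta>\<^sup>2\<close>; the parts of \<open>{0..l}\<close> outside of the polygon add at most \<open>e\<close>.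
\<close>

lemma negligible_not_nearly_straight:
  fixes f :: "real \<Rightarrow> real ^ 'n"
  assumes lip: "\<And>x y. x \<in> {0..l} \<Longrightarrow> y \<in> {0..l} \<Longrightarrow> dist (f x) (f y) \<le> \<bar>x - y\<bar>"
    and approx: "\<And>e. e > 0 \<Longrightarrow> \<exists>N p. mono p \<and> range p \<subseteq> {0..l} \<and> l - e < chord_sum f p N"
    and "0 < \<eta>"
  shows "negligible {t \<in> {0<..<l}. \<not> nearly_straight_at \<eta> f t}"
  unfolding negligible_outer_le
proof (intro allI impI)
  fix \<epsilon> :: real assume "0 < \<epsilon>"
  define e where "e = \<epsilon> / (1 + 4 / \<eta>\<^sup>2)"
  have "0 < 1 + 4 / \<eta>\<^sup>2" by (simp add: add_pos_nonneg)
  then have "0 < e" using \<open>0 < \<epsilon>\<close> by (simp add: e_def)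
  then obtain N p where p: "mono p" "range p \<subseteq> {0..l}" "l - e < chord_sum f p N" using approx by blast
  have p_in: "p i \<in> {0..l}" and p_mono: "p i \<le> p (Suc i)" for i
    using p(2) monoD[OF p(1), of i "Suc i"] by (blast, simp)
  define cell where "cell = (\<lambda>i (u :: real ^ 'n) B. norm u = 1 \<and> B \<in> lmeasurable \<and>
    measure lebesgue B \<le> 4 * ((p (Suc i) - p i) - dist (f (p i)) (f (p (Suc i)))) / \<eta>\<^sup>2 \<and>
    (\<forall>t\<in>{p i<..<p (Suc i)} - B. \<forall>s\<in>{p i<..<p (Suc i)}.
       norm (f s - f t - (s - t) *\<^sub>R u) \<le> \<eta> * \<bar>s - t\<bar>))"
  have "\<exists>u B. cell i u B" for i
    unfolding cell_def
  proof (rule nearly_straight_cell[OF p_mono _ \<open>0 < \<eta>\<close>])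
    fix s t assume "s \<in> {p i..p (Suc i)}" "t \<in> {p i..p (Suc i)}"
    then show "dist (f s) (f t) \<le> \<bar>s - t\<bar>"
      using p_in[of i] p_in[of "Suc i"] by (intro lip) auto
  qed
  then obtain u B where "\<And>i. cell i (u i) (B i)" by metis
  then have u: "\<And>i. norm (u i) = 1" and B: "\<And>i. B i \<in> lmeasurable"
    "\<And>i. measure lebesgue (B i) \<le> 4 * ((p (Suc i) - p i) - dist (f (p i)) (f (p (Suc i)))) / \<eta>\<^sup>2"
    and straight: "\<And>i t s. t \<in> {p i<..<p (Suc i)} - B i \<Longrightarrow> s \<in> {p i<..<p (Suc i)} \<Longrightarrow>
        norm (f s - f t - (s - t) *\<^sub>R u i) \<le> \<eta> * \<bar>s - t\<bar>"
    unfolding cell_def by blast+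
  define T where "T = ({0..p 0} \<union> {p N..l}) \<union> (p ` {..N} \<union> (\<Union>i<N. B i))"
  have fin: "negligible (p ` {..N})" by (simp add: negligible_finite)
  have meas: "{0..p 0} \<in> lmeasurable" "{p N..l} \<in> lmeasurable" "p ` {..N} \<in> lmeasurable" "(\<Union>i<N. B i) \<in> lmeasurable"
    using B(1) negligible_imp_measurable[OF fin] by auto
  then have T: "T \<in> lmeasurable" unfolding T_def by (intro fmeasurable.Un)
  have "chord_sum f p N \<le> (\<Sum>i<N. p (Suc i) - p i)"
    unfolding chord_sum_def
  proof (rule sum_mono)
    fix i
    show "dist (f (p i)) (f (p (Suc i))) \<le> p (Suc i) - p i"
      using lip[OF p_in p_in, of i "Suc i"] p_mono[of i] by simp
  qed
  also have "\<dots> = p N - p 0" by (rule sum_lessThan_telescope)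
  finally have len: "chord_sum f p N \<le> p N - p 0" .
  have "measure lebesgue T \<le> (measure lebesgue {0..p 0} + measure lebesgue {p N..l}) +
      (measure lebesgue (p ` {..N}) + measure lebesgue (\<Union>i<N. B i))"
    unfolding T_def using meas
    by (intro order_trans[OF measure_Un_le] add_mono measure_Un_le sets.Un fmeasurableD)
  also have "measure lebesgue (\<Union>i<N. B i) \<le> (\<Sum>i<N. measure lebesgue (B i))"
    using B(1) by (intro measure_UNION_le) (auto simp: fmeasurableD)
  also have "\<dots> \<le> (\<Sum>i<N. 4 * ((p (Suc i) - p i) - dist (f (p i)) (f (p (Suc i)))) / \<eta>\<^sup>2)"
    by (intro sum_mono B(2))
  also have "\<dots> = (\<Sum>i<N. 4 / \<eta>\<^sup>2 * ((p (Suc i) - p i) - dist (f (p i)) (f (p (Suc i)))))" by simp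
  also have "\<dots> = 4 / \<eta>\<^sup>2 * ((\<Sum>i<N. p (Suc i) - p i) - chord_sum f p N)"
    unfolding chord_sum_def sum_distrib_left[symmetric] by (simp only: sum_subtractf)
  also have "\<dots> = 4 / \<eta>\<^sup>2 * ((p N - p 0) - chord_sum f p N)" by (simp add: sum_lessThan_telescope)
  also have "\<dots> \<le> 4 / \<eta>\<^sup>2 * e"
    using p(3) p_in[of 0] p_in[of N] by (intro mult_left_mono) auto
  also have "measure lebesgue (p ` {..N}) = 0" using fin by (rule negligible_imp_measure0)
  also have "measure lebesgue {0..p 0} + measure lebesgue {p N..l} \<le> e"
    using p_in[of 0] p_in[of N] len p(3) by simp
  also have "e + (0 + 4 / \<eta>\<^sup>2 * e) = e * (1 + 4 / \<eta>\<^sup>2)" by (simp add: algebra_simps)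
  also have "\<dots> = \<epsilon>" using \<open>0 < 1 + 4 / \<eta>\<^sup>2\<close> by (simp add: e_def)
  finally have "measure lebesgue T \<le> \<epsilon>" by simp
  moreover have "{t \<in> {0<..<l}. \<not> nearly_straight_at \<eta> f t} \<subseteq> T"
  proof (rule subsetI, rule ccontr)
    fix t assume "t \<in> {t \<in> {0<..<l}. \<not> nearly_straight_at \<eta> f t}" and "t \<notin> T"
    then have t: "0 < t" "t < l" "\<not> nearly_straight_at \<eta> f t" "p 0 < t" "t < p N" "\<And>i. i \<le> N \<Longrightarrow> t \<noteq> p i"
      "\<And>i. i < N \<Longrightarrow> t \<notin> B i"
      by (auto simp: T_def)
    then obtain i where i: "i < N" "p i < t" "t < p (Suc i)" using cell_exists[of p t N] by blast
    define d where "d = min (t - p i) (p (Suc i) - t)"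
    have "d > 0" using i by (simp add: d_def)
    moreover have "norm (f s - f t - (s - t) *\<^sub>R u i) \<le> \<eta> * \<bar>s - t\<bar>" if "\<bar>s - t\<bar> < d" for s
      by (rule straight) (use that i t(7)[OF i(1)] in \<open>auto simp: d_def\<close>)
    ultimately show False using t(3) u[of i] unfolding nearly_straight_at_def by blast
  qed
  ultimately show "\<exists>T. {t \<in> {0<..<l}. \<not> nearly_straight_at \<eta> f t} \<subseteq> T \<and> T \<in> lmeasurable \<and> measure lebesgue T \<le> \<epsilon>"
    using T by blast
qed

text \<open>
  The approximate directions \<open>u n\<close> at accuracy \<open>1 / Suc n\<close> are unit vectors that form a Cauchy
  sequence, because any two of them approximate the same difference quotients. Their limit is the
  derivative.
\<close>

lemma tangent_ptI:
  fixes f :: "real \<Rightarrow> real ^ 'n"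
  assumes "\<And>n. nearly_straight_at (1 / Suc n) f t"
  shows "t \<in> tangent_pts f"
proof -
  obtain u d where u: "\<And>n. norm (u n :: real ^ 'n) = 1" and d: "\<And>n::nat. d n > (0::real)"
    and straight: "\<And>n s. \<bar>s - t\<bar> < d n \<Longrightarrow> norm (f s - f t - (s - t) *\<^sub>R u n) \<le> 1 / Suc n * \<bar>s - t\<bar>"
    using assms unfolding nearly_straight_at_def by metis
  have diff: "norm (u m - u n) \<le> 1 / Suc m + 1 / Suc n" for m n
  proof -
    define r where "r = min (d m) (d n) / 2"
    have r: "0 < r" "r < d m" "r < d n" using d[of m] d[of n] by (auto simp: r_def)
    have "r * norm (u m - u n) = norm (r *\<^sub>R (u m - u n))" using r by simp
    also have "r *\<^sub>R (u m - u n) = (f (t + r) - f t - r *\<^sub>R u n) - (f (t + r) - f t - r *\<^sub>R u m)"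
      by (simp add: scaleR_diff_right)
    also have "norm \<dots> \<le> norm (f (t + r) - f t - r *\<^sub>R u n) + norm (f (t + r) - f t - r *\<^sub>R u m)"
      by (rule norm_triangle_ineq4)
    also have "\<dots> \<le> 1 / Suc n * r + 1 / Suc m * r"
      using straight[of "t + r" n] straight[of "t + r" m] r by (intro add_mono) auto
    also have "\<dots> = r * (1 / Suc m + 1 / Suc n)" by (simp add: algebra_simps)
    finally show ?thesis using r by simp
  qed
  have "Cauchy u"
  proof (rule CauchyI)
    fix e :: real assume "0 < e"
    then obtain M :: nat where M: "1 / Suc M < e / 2" using nat_approx_posE[of "e/2"] by auto
    show "\<exists>M. \<forall>m\<ge>M. \<forall>n\<ge>M. norm (u m - u n) < e"
    proof (intro exI[of _ M] allI impI)
      fix m n assume "M \<le> m" "M \<le> n"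
      then have "1 / Suc m \<le> 1 / Suc M" "1 / Suc n \<le> 1 / Suc M" by (auto simp: frac_le)
      then show "norm (u m - u n) < e" using diff[of m n] M by linarith
    qed
  qed
  then obtain v where v: "u \<longlonglongrightarrow> v" using Cauchy_convergent convergent_def by blast
  have "norm v = 1"
    using tendsto_norm[OF v] u by (simp add: LIMSEQ_const_iff)
  have diffv: "norm (u m - v) \<le> 1 / Suc m" for m
  proof -
    have "(\<lambda>n. norm (u m - u n)) \<longlonglongrightarrow> norm (u m - v)" by (intro tendsto_intros v)
    moreover have "(\<lambda>n. 1 / Suc m + 1 / Suc n) \<longlonglongrightarrow> 1 / Suc m + 0"
      by (intro tendsto_intros LIMSEQ_Suc[OF lim_1_over_n])
    ultimately show ?thesis using diff by (auto intro!: LIMSEQ_le)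
  qed
  have "(f has_vector_derivative v) (at t)"
    unfolding has_vector_derivative_def has_derivative_at_alt
  proof (intro conjI allI impI bounded_linear_scaleR_left)
    fix e :: real assume "0 < e"
    then obtain M :: nat where M: "1 / Suc M < e / 2" using nat_approx_posE[of "e/2"] by auto
    show "\<exists>d>0. \<forall>y. norm (y - t) < d \<longrightarrow> norm (f y - f t - (y - t) *\<^sub>R v) \<le> e * norm (y - t)"
    proof (intro exI[of _ "d M"] conjI allI impI d)
      fix y assume "norm (y - t) < d M"
      then have "norm (f y - f t - (y - t) *\<^sub>R u M) \<le> 1 / Suc M * \<bar>y - t\<bar>" using straight by simp
      moreover have "norm ((y - t) *\<^sub>R (u M - v)) \<le> \<bar>y - t\<bar> * (1 / Suc M)"
        unfolding norm_scaleR using diffv[of M] by (intro mult_left_mono) auto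
      moreover have "f y - f t - (y - t) *\<^sub>R v = (f y - f t - (y - t) *\<^sub>R u M) + (y - t) *\<^sub>R (u M - v)"
        by (simp add: algebra_simps)
      then have "norm (f y - f t - (y - t) *\<^sub>R v) \<le>
          norm (f y - f t - (y - t) *\<^sub>R u M) + norm ((y - t) *\<^sub>R (u M - v))"
        by (metis norm_triangle_ineq)
      ultimately have "norm (f y - f t - (y - t) *\<^sub>R v) \<le> 2 * (1 / Suc M) * \<bar>y - t\<bar>"
        by (simp add: algebra_simps)
      also have "\<dots> \<le> e * \<bar>y - t\<bar>" using M by (intro mult_right_mono) auto
      finally show "norm (f y - f t - (y - t) *\<^sub>R v) \<le> e * norm (y - t)" by simp
    qed
  qed
  then show ?thesis
    using \<open>norm v = 1\<close> by (auto simp: tangent_pts_def vector_derivative_at intro: differentiableI_vector)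
qed

lemma AE_tangent_pts:
  fixes f :: "real \<Rightarrow> real ^ 'n"
  assumes lip: "\<And>x y. x \<in> {0..l} \<Longrightarrow> y \<in> {0..l} \<Longrightarrow> dist (f x) (f y) \<le> \<bar>x - y\<bar>"
    and approx: "\<And>e. e > 0 \<Longrightarrow> \<exists>N p. mono p \<and> range p \<subseteq> {0..l} \<and> l - e < chord_sum f p N"
  shows "AE t in lborel. t \<in> {0..l} \<longrightarrow> t \<in> tangent_pts f"
proof -
  have "negligible (({0} \<union> {l}) \<union> (\<Union>n. {t \<in> {0<..<l}. \<not> nearly_straight_at (1 / Suc n) f t}))"
    by (intro negligible_Un negligible_sing negligible_Union_nat negligible_not_nearly_straight[OF lip approx]) auto
  then have "negligible {t \<in> {0..l}. t \<notin> tangent_pts f}"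
    by (rule negligible_subset) (use tangent_ptI in fastforce)
  then have "AE t in lebesgue. t \<notin> {t \<in> {0..l}. t \<notin> tangent_pts f}"
    unfolding negligible_iff_null_sets by (rule AE_not_in)
  then have "AE t in lborel. t \<notin> {t \<in> {0..l}. t \<notin> tangent_pts f}" by (simp add: AE_completion_iff)
  then show ?thesis by (rule AE_mp) auto
qed

section \<open>Angles between lines\<close>

text \<open>
  The distance between the lines spanned by \<open>x\<close> and \<open>y\<close>: unit vectors are compared up to sign, as
  a tangent line carries no orientation.
\<close>

definition axis_dist :: "real ^ 'n \<Rightarrow> real ^ 'n \<Rightarrow> real" where
  "axis_dist x y = min (norm (sgn x - sgn y)) (norm (sgn x + sgn y))"

lemma axis_dist_commute: "axis_dist x y = axis_dist y x"
  by (simp add: axis_dist_def norm_minus_commute add.commute[of "sgn x"])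

lemma axis_dist_minus [simp]: "axis_dist (- x) (- y) = axis_dist x y"
proof -
  have "- sgn x - sgn y = - (sgn x + sgn y)" "- sgn x + sgn y = - (sgn x - sgn y)" by simp_all
  then show ?thesis by (simp add: axis_dist_def sgn_minus norm_minus_commute min.commute
      add.commute[of "sgn x" "sgn y"] del: minus_add_distrib)
qed

lemma axis_dist_triangle: "axis_dist x z \<le> axis_dist x y + axis_dist y z"
proof -
  have "norm (a - c) \<le> norm (a - b) + norm (b - c)" "norm (a - c) \<le> norm (a + b) + norm (b + c)"
    "norm (a + c) \<le> norm (a - b) + norm (b + c)" "norm (a + c) \<le> norm (a + b) + norm (b - c)"
    for a b c :: "real ^ 'n"
    using norm_triangle_ineq[of "a - b" "b - c"] norm_triangle_ineq4[of "a + b" "b + c"]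
      norm_triangle_ineq[of "a - b" "b + c"] norm_triangle_ineq4[of "a + b" "b - c"]
    by simp_all
  from this[of "sgn x" "sgn z" "sgn y"] show ?thesis
    unfolding axis_dist_def by linarith
qed

lemma axis_dist_le_of_near_line:
  assumes "v \<noteq> 0" and "norm \<tau> = 1" and near: "norm (v - \<mu> *\<^sub>R \<tau>) \<le> e"
  shows "axis_dist v \<tau> \<le> 2 * e / norm v"
proof -
  have sgn_\<tau>: "sgn \<tau> = \<tau>" using \<open>norm \<tau> = 1\<close> by (simp add: sgn_div_norm)
  have *: "norm (sgn v - \<rho>) \<le> 2 * e / norm v"
    if \<rho>: "norm \<rho> = 1" "norm (v - \<nu> *\<^sub>R \<rho>) \<le> e" "0 \<le> \<nu>" for \<rho> \<nu>
  proof -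
    have "norm v * norm (sgn v - \<rho>) = norm (norm v *\<^sub>R (sgn v - \<rho>))" by simp
    also have "norm v *\<^sub>R (sgn v - \<rho>) = (v - \<nu> *\<^sub>R \<rho>) + (\<nu> - norm v) *\<^sub>R \<rho>"
      using \<open>v \<noteq> 0\<close> by (simp add: sgn_div_norm algebra_simps)
    also have "norm \<dots> \<le> norm (v - \<nu> *\<^sub>R \<rho>) + norm ((\<nu> - norm v) *\<^sub>R \<rho>)" by (rule norm_triangle_ineq)
    also have "norm ((\<nu> - norm v) *\<^sub>R \<rho>) \<le> norm (v - \<nu> *\<^sub>R \<rho>)"
      using norm_triangle_ineq3[of v "\<nu> *\<^sub>R \<rho>"] \<rho> by (simp add: abs_minus_commute)
    also have "norm (v - \<nu> *\<^sub>R \<rho>) + norm (v - \<nu> *\<^sub>R \<rho>) \<le> 2 * e" using \<rho>(2) by simp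
    finally show ?thesis using \<open>v \<noteq> 0\<close> by (simp add: pos_le_divide_eq mult.commute)
  qed
  show ?thesis
  proof (cases "0 \<le> \<mu>")
    case True
    then have "norm (sgn v - \<tau>) \<le> 2 * e / norm v" using * assms by blast
    then show ?thesis unfolding axis_dist_def sgn_\<tau> by (rule min.coboundedI1)
  next
    case False
    then have "norm (sgn v - (- \<tau>)) \<le> 2 * e / norm v"
      using *[of "- \<tau>" "- \<mu>"] assms by simp
    then have "norm (sgn v + \<tau>) \<le> 2 * e / norm v" by simp
    then show ?thesis unfolding axis_dist_def sgn_\<tau> by (rule min.coboundedI2)
  qed
qed

section \<open>Bounded energy makes the image flat\<close>

text \<open>
  A bound \<open>1 / r powr q \<le> K\<close> for the tangent-point radius \<open>r\<close> bounds the distance from \<open>f s\<close> to the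
  tangent line by half of \<open>K powr (1 / q) * (norm (f t - f s))\<^sup>2\<close>. Dropping the factor one half
  makes the inequality strict, so that it passes from the infimum to some point of the line.
\<close>

lemma near_tangent_line:
  fixes f :: "real \<Rightarrow> real ^ 'n"
  assumes le: "inverse_power q (tp_radius f t s) \<le> ennreal K" and "0 < q" "0 < K" and ne: "f t \<noteq> f s"
  shows "\<exists>\<mu>. norm (f s - f t - \<mu> *\<^sub>R vector_derivative f (at t)) < K powr (1 / q) * (norm (f t - f s))\<^sup>2"
proof -
  define A where "A = (norm (f t - f s))\<^sup>2"
  define k where "k = K powr (1 / q)"
  define D where "D = infdist (f s) (tangent_line f t)"
  have pos: "A > 0" "k > 0" using ne \<open>0 < K\<close> by (auto simp: A_def k_def)
  have "D < k * A"
  proof (cases "f s \<in> tangent_line f t")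
    case True
    then show ?thesis using pos by (simp add: D_def infdist_zero)
  next
    case False
    have "D \<noteq> 0"
    proof
      assume "D = 0"
      then have "tp_radius f t s = 0" using ne False by (simp add: tp_radius_def D_def)
      then show False using le by (simp add: inverse_power_def top_unique)
    qed
    then have "D > 0" using infdist_nonneg[of "f s" "tangent_line f t"] by (simp add: D_def)
    have "tp_radius f t s = ennreal (A / (2 * D))"
      using ne False by (simp add: tp_radius_def D_def A_def)
    moreover have "A / (2 * D) > 0" using pos \<open>D > 0\<close> by simp
    ultimately have "inverse_power q (tp_radius f t s) = ennreal (1 / (A / (2 * D)) powr q)"
      using pos \<open>D > 0\<close> by (simp add: inverse_power_def)
    with le have "1 / (A / (2 * D)) powr q \<le> K" using \<open>0 < K\<close> by simp
    then have "(2 * D / A) powr q \<le> K" using pos \<open>D > 0\<close> by (simp add: powr_divide)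
    then have "((2 * D / A) powr q) powr (1 / q) \<le> K powr (1 / q)"
      using \<open>0 < q\<close> by (intro powr_mono2) auto
    then have "2 * D / A \<le> k" using \<open>0 < q\<close> pos \<open>D > 0\<close> by (simp add: powr_powr k_def)
    then have "2 * D \<le> k * A" using pos by (simp add: field_simps)
    then show ?thesis using \<open>D > 0\<close> by linarith
  qed
  moreover have ne: "tangent_line f t \<noteq> {}" by (auto simp: tangent_line_def)
  ultimately have "(INF a\<in>tangent_line f t. dist (f s) a) < k * A"
    by (simp add: D_def infdist_def)
  then obtain a where a: "a \<in> tangent_line f t" "dist (f s) a < k * A"
    using ne by (subst (asm) cINF_less_iff) (auto intro: bdd_belowI[of _ 0])
  then obtain \<mu> where "a = f t + \<mu> *\<^sub>R vector_derivative f (at t)" by (auto simp: tangent_line_def)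
  then have "dist (f s) a = norm (f s - f t - \<mu> *\<^sub>R vector_derivative f (at t))"
    by (simp add: dist_norm algebra_simps)
  with a(2) show ?thesis unfolding k_def A_def by metis
qed

text \<open>
  If every tangent point \<open>t\<close> in the first window fails for one of the other two windows, then the
  inner integral is at least \<open>K * W\<close> at each of them, and the energy is at least
  \<open>K * W\<^sup>2\<close>. One and the same \<open>t\<close> serves both windows, which is what makes it possible to
  compare the directions towards two points.
\<close>

lemma common_good_tangent_pt:
  fixes f :: "real \<Rightarrow> real ^ 'n"
  assumes tang: "AE t in lborel. t \<in> {0..l} \<longrightarrow> t \<in> tangent_pts f"
    and energy: "tp_energy q l f \<le> ennreal M" and "0 < W" "0 \<le> M" "M < K * W\<^sup>2"
    and sub: "{a..a + W} \<subseteq> {0..l}" "{b..b + W} \<subseteq> {0..l}" "{c..c + W} \<subseteq> {0..l}"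
  shows "\<exists>t\<in>{a..a + W} \<inter> tangent_pts f. \<exists>s\<in>{b..b + W}. \<exists>s'\<in>{c..c + W}.
    inverse_power q (tp_radius f t s) \<le> ennreal K \<and> inverse_power q (tp_radius f t s') \<le> ennreal K"
proof (rule ccontr)
  assume no: "\<not> ?thesis"
  have "0 < K * W\<^sup>2" using \<open>0 \<le> M\<close> \<open>M < K * W\<^sup>2\<close> by linarith
  then have "0 < K" using \<open>0 < W\<close> by (simp add: zero_less_mult_iff)
  define I where "I = (\<lambda>t. \<integral>\<^sup>+ s \<in> {0..l}. inverse_power q (tp_radius f t s) \<partial>lborel)"
  have large: "ennreal (K * W) \<le> I t"
    if d: "{d..d + W} \<subseteq> {0..l}" "\<And>s. s \<in> {d..d + W} \<Longrightarrow> ennreal K \<le> inverse_power q (tp_radius f t s)" for t d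
  proof -
    have "ennreal (K * W) = (\<integral>\<^sup>+ s. ennreal K * indicator {d..d + W} s \<partial>lborel)"
      using \<open>0 < W\<close> \<open>0 < K\<close> by (simp add: nn_integral_cmult_indicator ennreal_mult)
    also have "\<dots> \<le> I t"
      unfolding I_def by (intro nn_integral_mono) (use d in \<open>auto simp: indicator_def\<close>)
    finally show ?thesis .
  qed
  have I_large: "ennreal (K * W) \<le> I t" if t: "t \<in> {a..a + W} \<inter> tangent_pts f" for t
  proof (cases "\<exists>s\<in>{b..b + W}. inverse_power q (tp_radius f t s) \<le> ennreal K")
    case True
    then have "\<not> inverse_power q (tp_radius f t s') \<le> ennreal K" if "s' \<in> {c..c + W}" for s'
      using no t that by blast
    then show ?thesis by (intro large[OF sub(3)]) (meson linear)
  next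
    case False
    then show ?thesis by (intro large[OF sub(2)]) (meson linear)
  qed
  have "ennreal (K * W * W) = (\<integral>\<^sup>+ t. ennreal (K * W) * indicator {a..a + W} t \<partial>lborel)"
    using \<open>0 < W\<close> \<open>0 < K\<close> by (simp add: nn_integral_cmult_indicator ennreal_mult)
  also have "\<dots> \<le> (\<integral>\<^sup>+ t \<in> {0..l} \<inter> tangent_pts f. I t \<partial>lborel)"
  proof (rule nn_integral_mono_AE)
    show "AE t in lborel. ennreal (K * W) * indicator {a..a + W} t \<le> I t * indicator ({0..l} \<inter> tangent_pts f) t"
      using tang
    proof eventually_elim
      case (elim t)
      then show ?case using I_large[of t] sub(1) by (auto simp: indicator_def)
    qed
  qed
  also have "\<dots> = tp_energy q l f" by (simp add: tp_energy_def I_def)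
  also note energy
  finally have "K * W * W \<le> M" using \<open>0 \<le> M\<close> by simp
  then show False using \<open>M < K * W\<^sup>2\<close> by (simp add: power2_eq_square mult.assoc)
qed

lemma window_exists:
  fixes a :: real
  assumes "a \<in> {0..l}" "0 \<le> W" "W \<le> l"
  shows "\<exists>a'. a \<in> {a'..a' + W} \<and> {a'..a' + W} \<subseteq> {0..l}"
  by (rule exI[of _ "min a (l - W)"]) (use assms in \<open>auto simp: min_def\<close>)

text \<open>
  Both directions are compared with a tangent \<open>\<tau>\<close> at a common good parameter. Moving from the
  points to parameters in the windows costs \<open>W\<close> at either end, and the distance to the tangent
  line is of order \<open>K powr (1 / q) * D\<^sup>2\<close> with \<open>K = (M + 1) / W\<^sup>2\<close>. Dividing by \<open>D\<close> turns these
  lengths into angles of order \<open>W / D = D powr \<beta>\<close>. The smallness assumption ensures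
  \<open>W \<le> D / 8\<close>, so that the windows do not blur the distances between the points.
\<close>

lemma energy_flatness:
  fixes f :: "real \<Rightarrow> real ^ 'n"
  assumes lip: "\<And>x y. x \<in> {0..l} \<Longrightarrow> y \<in> {0..l} \<Longrightarrow> dist (f x) (f y) \<le> \<bar>x - y\<bar>"
    and tang: "AE t in lborel. t \<in> {0..l} \<longrightarrow> t \<in> tangent_pts f"
    and energy: "tp_energy q l f \<le> ennreal M" and "0 \<le> M" and "2 < q"
    and X: "y \<in> f ` {0..l}" "z \<in> f ` {0..l}" "w \<in> f ` {0..l}"
    and comparable: "norm (z - y) \<le> norm (w - y)" "norm (w - y) \<le> 2 * norm (z - y)" "y \<noteq> z"
  defines "\<beta> \<equiv> (q - 2) / (q + 2)"
  assumes small: "norm (w - y) powr \<beta> \<le> 1 / 8"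
  shows "axis_dist (z - y) (w - y) \<le> 8 * (2 + 4 * (M + 1) powr (1 / q)) * norm (w - y) powr \<beta>"
proof -
  define D where "D = norm (w - y)"
  have "0 < norm (z - y)" using comparable(3) by simp
  then have "0 < D" using comparable(1) unfolding D_def by linarith
  define W where "W = D * D powr \<beta>"
  have "0 < W" using \<open>0 < D\<close> by (simp add: W_def)
  have W_le: "W \<le> D / 8" using small \<open>0 < D\<close> by (simp add: W_def D_def)
  obtain a b c where abc: "a \<in> {0..l}" "f a = y" "b \<in> {0..l}" "f b = z" "c \<in> {0..l}" "f c = w"
    using X by blast
  have "D \<le> l"
    using lip[OF abc(5,1)] abc by (auto simp: D_def dist_norm)
  then have "0 \<le> W" "W \<le> l" using \<open>0 < W\<close> W_le \<open>0 < D\<close> by linarith+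
  then obtain a' b' c' where win:
    "a \<in> {a'..a' + W}" "{a'..a' + W} \<subseteq> {0..l}" "b \<in> {b'..b' + W}" "{b'..b' + W} \<subseteq> {0..l}"
    "c \<in> {c'..c' + W}" "{c'..c' + W} \<subseteq> {0..l}"
    using window_exists abc by metis
  \<comment> \<open>Adding 1 makes \<open>K * W\<^sup>2\<close> exceed \<open>M\<close> strictly and keeps \<open>K\<close> positive when \<open>M\<close> is 0.\<close>
  define K where "K = (M + 1) / W\<^sup>2"
  have "0 < K" "M < K * W\<^sup>2" using \<open>0 < W\<close> \<open>0 \<le> M\<close> by (simp_all add: K_def)
  then obtain t s s' where t: "t \<in> {a'..a' + W}" "t \<in> tangent_pts f"
    and s: "s \<in> {b'..b' + W}" "inverse_power q (tp_radius f t s) \<le> ennreal K"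
    and s': "s' \<in> {c'..c' + W}" "inverse_power q (tp_radius f t s') \<le> ennreal K"
    using common_good_tangent_pt[OF tang energy \<open>0 < W\<close> \<open>0 \<le> M\<close> \<open>M < K * W\<^sup>2\<close> win(2,4,6)] by blast
  define \<tau> where "\<tau> = vector_derivative f (at t)"
  have "norm \<tau> = 1" using t(2) by (simp add: \<tau>_def tangent_pts_def)
  define k where "k = (M + 1) powr (1 / q)"
  \<comment> \<open>The exponent \<open>\<beta>\<close> is chosen for this balance of the two errors.\<close>
  have K_root: "K powr (1 / q) * D\<^sup>2 = k * W"
  proof -
    have W_powr: "W = D powr (1 + \<beta>)" using \<open>0 < D\<close> by (simp add: W_def powr_add)
    have "1 + \<beta> = 2 * q / (q + 2)" using \<open>2 < q\<close> by (simp add: \<beta>_def field_simps)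
    moreover from this have "(1 + \<beta>) * 2 / q = 4 / (q + 2)" using \<open>2 < q\<close> by simp
    ultimately have e: "2 + - ((1 + \<beta>) * 2 / q) = 1 + \<beta>" using \<open>2 < q\<close> by (simp add: field_simps)
    have "K powr (1 / q) = k / (W powr 2) powr (1 / q)"
      using \<open>0 \<le> M\<close> \<open>0 < W\<close> by (simp add: K_def k_def powr_divide)
    also have "\<dots> = k * D powr (- ((1 + \<beta>) * 2 / q))"
      by (simp add: W_powr powr_powr powr_minus divide_inverse)
    finally have "K powr (1 / q) * D\<^sup>2 = k * (D powr 2 * D powr (- ((1 + \<beta>) * 2 / q)))"
      using \<open>0 < D\<close> by simp
    also have "\<dots> = k * W" by (simp only: powr_add[symmetric] e W_powr)
    finally show ?thesis .
  qed
  have near: "axis_dist (x - y) \<tau> \<le> 4 * (2 + 4 * k) * D powr \<beta>"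
    if x: "f \<sigma> = x" "\<sigma> \<in> {0..l}" "\<sigma> \<in> {d..d + W}" "{d..d + W} \<subseteq> {0..l}" "D / 2 \<le> norm (x - y)" "norm (x - y) \<le> D"
      and r: "r \<in> {d..d + W}" "inverse_power q (tp_radius f t r) \<le> ennreal K" for x \<sigma> d r
  proof -
    have "r \<in> {0..l}" using x(4) r(1) by blast
    then have "dist (f r) (f \<sigma>) \<le> \<bar>r - \<sigma>\<bar>" using x(2) by (rule lip)
    also have "\<dots> \<le> W" using x(3) r(1) by auto
    finally have "dist (f r) x \<le> W" by (simp only: x(1))
    then have frx: "norm (f r - x) \<le> W" by (simp add: dist_norm)
    have "t \<in> {0..l}" using win(2) t(1) by blast
    then have "dist (f t) (f a) \<le> \<bar>t - a\<bar>" using abc(1) by (rule lip)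
    also have "\<dots> \<le> W" using win(1) t(1) by auto
    finally have "dist (f t) y \<le> W" by (simp only: abc(2))
    then have fty: "norm (f t - y) \<le> W" by (simp add: dist_norm)
    have eq: "f t - f r = (f t - y) - (f r - x) - (x - y)" by simp
    have "norm (f t - f r) \<le> norm (f t - y) + norm (f r - x) + norm (x - y)"
      unfolding eq by (rule order_trans[OF norm_triangle_ineq4 add_right_mono[OF norm_triangle_ineq4]])
    then have up: "norm (f t - f r) \<le> 2 * D" using frx fty x W_le \<open>0 < D\<close> by linarith
    have "norm (x - y) \<le> norm (f t - f r) + norm (f t - y) + norm (f r - x)"
      using norm_triangle_ineq4[of "(f t - y) - (f r - x)" "f t - f r"] norm_triangle_ineq4[of "f t - y" "f r - x"]
      by simp
    then have "f t \<noteq> f r" using frx fty x W_le \<open>0 < D\<close> by auto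
    then obtain \<mu> where \<mu>: "norm (f r - f t - \<mu> *\<^sub>R \<tau>) < K powr (1 / q) * (norm (f t - f r))\<^sup>2"
      using near_tangent_line[OF r(2)] \<open>2 < q\<close> \<open>0 < K\<close> unfolding \<tau>_def by auto
    also have "\<dots> \<le> K powr (1 / q) * (2 * D)\<^sup>2"
      using up by (intro mult_left_mono power_mono) auto
    also have "\<dots> = 4 * k * W" using K_root by (simp add: power_mult_distrib)
    finally have near_line: "norm (f r - f t - \<mu> *\<^sub>R \<tau>) \<le> 4 * k * W" by simp
    have eq': "x - y - \<mu> *\<^sub>R \<tau> = (f r - f t - \<mu> *\<^sub>R \<tau>) - (f r - x) + (f t - y)" by simp
    have "norm (x - y - \<mu> *\<^sub>R \<tau>) \<le> norm (f r - f t - \<mu> *\<^sub>R \<tau>) + norm (f r - x) + norm (f t - y)"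
      unfolding eq' by (rule order_trans[OF norm_triangle_ineq add_right_mono[OF norm_triangle_ineq4]])
    then have "norm (x - y - \<mu> *\<^sub>R \<tau>) \<le> (2 + 4 * k) * W" using near_line frx fty by (simp add: algebra_simps)
    moreover have "x - y \<noteq> 0" using x \<open>0 < D\<close> by auto
    ultimately have "axis_dist (x - y) \<tau> \<le> 2 * ((2 + 4 * k) * W) / norm (x - y)"
      using \<open>norm \<tau> = 1\<close> by (intro axis_dist_le_of_near_line)
    also have "\<dots> \<le> 2 * ((2 + 4 * k) * W) / (D / 2)"
      using x \<open>0 < D\<close> \<open>0 < W\<close> by (intro divide_left_mono) (auto simp: k_def intro!: mult_pos_pos)
    also have "\<dots> = 4 * (2 + 4 * k) * D powr \<beta>" using \<open>0 < D\<close> by (simp add: W_def)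
    finally show ?thesis .
  qed
  have "axis_dist (z - y) \<tau> \<le> 4 * (2 + 4 * k) * D powr \<beta>"
    by (rule near[OF abc(4,3) win(3,4) _ _ s]) (use comparable in \<open>auto simp: D_def\<close>)
  moreover have "axis_dist (w - y) \<tau> \<le> 4 * (2 + 4 * k) * D powr \<beta>"
    by (rule near[OF abc(6,5) win(5,6) _ _ s']) (use \<open>0 < D\<close> in \<open>auto simp: D_def\<close>)
  ultimately show ?thesis
    using axis_dist_triangle[of "z - y" "w - y" \<tau>] axis_dist_commute[of "w - y" \<tau>]
    by (simp add: D_def k_def algebra_simps)
qed

section \<open>From flatness to a Lipschitz graph\<close>

text \<open>
  Descend from \<open>w\<close> to \<open>z\<close> through points of \<open>X\<close> at distances \<open>norm (w - y) / 2 ^ j\<close> from \<open>y\<close>. The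
  angles turned are bounded by the geometric series with ratio \<open>2 powr (- \<beta>)\<close>, summed here as the
  fixed point \<open>A\<close> of \<open>A * 2 powr (- \<beta>) + C = A\<close>.
\<close>

lemma axis_dist_chain:
  fixes X :: "(real ^ 'n) set"
  assumes flat: "\<And>y z w. y \<in> X \<Longrightarrow> z \<in> X \<Longrightarrow> w \<in> X \<Longrightarrow> y \<noteq> z \<Longrightarrow> norm (z - y) \<le> norm (w - y) \<Longrightarrow>
      norm (w - y) \<le> 2 * norm (z - y) \<Longrightarrow> norm (w - y) \<le> R \<Longrightarrow>
      axis_dist (z - y) (w - y) \<le> C * norm (w - y) powr \<beta>"
    and pts: "\<And>y r. y \<in> X \<Longrightarrow> 0 < r \<Longrightarrow> r \<le> R / 2 \<Longrightarrow> \<exists>p\<in>X. norm (p - y) = r"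
    and "0 < \<beta>" "0 \<le> C"
    and X: "y \<in> X" "z \<in> X" "w \<in> X" and "y \<noteq> z" "norm (z - y) \<le> norm (w - y)" "norm (w - y) \<le> R"
  shows "axis_dist (z - y) (w - y) \<le> C / (1 - 2 powr (- \<beta>)) * norm (w - y) powr \<beta>"
proof -
  define A where "A = C / (1 - 2 powr (- \<beta>))"
  have "2 powr (- \<beta>) < 2 powr 0" using \<open>0 < \<beta>\<close> by (intro powr_less_mono) auto
  then have lt1: "2 powr (- \<beta>) < (1 :: real)" by simp
  then have "A * (1 - 2 powr (- \<beta>)) = C" using \<open>0 < \<beta>\<close> by (simp add: A_def)
  then have A_eq: "A * 2 powr (- \<beta>) + C = A" by (simp add: algebra_simps)
  have "0 \<le> A" using lt1 \<open>0 \<le> C\<close> by (simp add: A_def)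
  then have "0 \<le> A * 2 powr (- \<beta>)" by simp
  then have "C \<le> A" using A_eq by linarith
  have comparable: "axis_dist (z - y) (w - y) \<le> A * norm (w - y) powr \<beta>"
    if "w \<in> X" "norm (z - y) \<le> norm (w - y)" "norm (w - y) \<le> 2 * norm (z - y)" "norm (w - y) \<le> R" for w
    using flat[OF X(1,2) that(1) \<open>y \<noteq> z\<close> that(2-4)] mult_right_mono[OF \<open>C \<le> A\<close>, of "norm (w - y) powr \<beta>"] by simp
  have "axis_dist (z - y) (w - y) \<le> A * norm (w - y) powr \<beta>"
    if "w \<in> X" "norm (z - y) \<le> norm (w - y)" "norm (w - y) \<le> 2 ^ n * norm (z - y)" "norm (w - y) \<le> R" for n w
    using that
  proof (induction n arbitrary: w)
    case 0
    show ?case by (rule comparable[OF 0(1,2)]) (use 0 in auto)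
  next
    case (Suc n)
    show ?case
    proof (cases "norm (w - y) \<le> 2 * norm (z - y)")
      case True
      then show ?thesis using comparable Suc.prems by blast
    next
      case False
      then have "0 < norm (w - y)" using norm_ge_zero[of "z - y"] by linarith
      then obtain p where p: "p \<in> X" "norm (p - y) = norm (w - y) / 2"
        using pts[OF X(1), of "norm (w - y) / 2"] Suc.prems by auto
      have "norm (p - y) \<le> R" using p(2) Suc.prems(4) \<open>0 < norm (w - y)\<close> by linarith
      moreover have "norm (z - y) \<le> norm (p - y)" using p(2) False by linarith
      moreover have "norm (p - y) \<le> 2 ^ n * norm (z - y)" using p(2) Suc.prems(3) by simp
      ultimately have "axis_dist (z - y) (p - y) \<le> A * norm (p - y) powr \<beta>"
        using Suc.IH[OF p(1)] by blast
      also have "norm (p - y) powr \<beta> = 2 powr (- \<beta>) * norm (w - y) powr \<beta>"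
        unfolding p(2) by (simp add: powr_divide powr_minus_divide)
      finally have "axis_dist (z - y) (p - y) \<le> A * 2 powr (- \<beta>) * norm (w - y) powr \<beta>" by simp
      moreover have "axis_dist (p - y) (w - y) \<le> C * norm (w - y) powr \<beta>"
      proof (rule flat[OF X(1) p(1) Suc.prems(1)])
        show "y \<noteq> p" using p(2) \<open>0 < norm (w - y)\<close> by auto
        show "norm (p - y) \<le> norm (w - y)" using p(2) \<open>0 < norm (w - y)\<close> by linarith
        show "norm (w - y) \<le> 2 * norm (p - y)" using p(2) by simp
      qed (rule Suc.prems(4))
      ultimately have "axis_dist (z - y) (w - y) \<le> (A * 2 powr (- \<beta>) + C) * norm (w - y) powr \<beta>"
        using axis_dist_triangle[of "z - y" "w - y" "p - y"] by (simp add: distrib_right)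
      then show ?thesis by (simp only: A_eq)
    qed
  qed
  moreover obtain n where "norm (w - y) / norm (z - y) < 2 ^ n"
    using real_arch_pow[of 2 "norm (w - y) / norm (z - y)"] by auto
  then have "norm (w - y) \<le> 2 ^ n * norm (z - y)"
    using \<open>y \<noteq> z\<close> by (simp add: divide_less_eq)
  ultimately show ?thesis unfolding A_def[symmetric] using assms by blast
qed

text \<open>
  Unit vectors \<open>a\<close>, \<open>b\<close> with \<open>norm (a - b) < 1\<close> satisfy \<open>2 * (a \<bullet> b) = 2 - (norm (a - b))\<^sup>2 > 1\<close>.
\<close>

lemma inner_ge_of_axis_dist:
  assumes "axis_dist v w < 1" "w \<noteq> 0"
  shows "norm v / 2 \<le> \<bar>v \<bullet> sgn w\<bar>"
proof (cases "v = 0")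
  case False
  have *: "1 / 2 < a \<bullet> b" if "norm a = 1" "norm b = 1" "norm (a - b) < 1" for a b :: "real ^ 'a"
  proof -
    have "(norm (a - b))\<^sup>2 < 1" using that(3) by (simp add: power_less_one_iff)
    then show ?thesis using that(1,2) dot_norm_neg[of a b] by simp
  qed
  have unit: "norm (sgn v) = 1" "norm (sgn w) = 1" using False \<open>w \<noteq> 0\<close> by (simp_all add: norm_sgn)
  have "1 / 2 < \<bar>sgn v \<bullet> sgn w\<bar>"
  proof (cases "norm (sgn v - sgn w) < 1")
    case True
    then show ?thesis using *[OF unit] by linarith
  next
    case False
    then have "norm (sgn v - (- sgn w)) < 1" using assms by (simp add: axis_dist_def min_less_iff_disj)
    then have "1 / 2 < sgn v \<bullet> (- sgn w)" using * unit by (metis norm_minus_cancel)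
    then show ?thesis by simp
  qed
  then have "norm v * (1 / 2) \<le> norm v * \<bar>sgn v \<bullet> sgn w\<bar>" by (intro mult_left_mono) auto
  also have "\<dots> = \<bar>(norm v *\<^sub>R sgn v) \<bullet> sgn w\<bar>" by (simp add: abs_mult)
  also have "norm v *\<^sub>R sgn v = v" using False by (simp add: sgn_div_norm)
  finally show ?thesis by simp
qed simp

text \<open>
  The direction \<open>u\<close> points from \<open>x\<close> to some \<open>p\<close> in \<open>X\<close> at distance \<open>4 * \<rho>\<close>. A chord from \<open>y\<close> to \<open>z\<close>
  in the ball has length at most \<open>2 * \<rho>\<close> and is compared first with \<open>p - y\<close>, using the base point
  \<open>y\<close>, and then \<open>p - y\<close> is compared with \<open>p - x\<close>, using the base point \<open>p\<close>. All distances involved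
  are at most \<open>5 * \<rho>\<close>.
\<close>

lemma lipschitz_graph:
  fixes X :: "(real ^ 'n) set"
  assumes flat: "\<And>y z w. y \<in> X \<Longrightarrow> z \<in> X \<Longrightarrow> w \<in> X \<Longrightarrow> y \<noteq> z \<Longrightarrow> norm (z - y) \<le> norm (w - y) \<Longrightarrow>
      norm (w - y) \<le> 2 * norm (z - y) \<Longrightarrow> norm (w - y) \<le> 8 * \<rho> \<Longrightarrow>
      axis_dist (z - y) (w - y) \<le> C * norm (w - y) powr \<beta>"
    and pts: "\<And>y r. y \<in> X \<Longrightarrow> 0 < r \<Longrightarrow> r \<le> 4 * \<rho> \<Longrightarrow> \<exists>p\<in>X. norm (p - y) = r"
    and "0 < \<beta>" "0 \<le> C" "0 < \<rho>" and small: "2 * (C / (1 - 2 powr (- \<beta>))) * (8 * \<rho>) powr \<beta> < 1"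
    and "x \<in> X"
  shows "\<exists>u. norm u = 1 \<and> (\<forall>y\<in>X \<inter> cball x \<rho>. \<forall>z\<in>X \<inter> cball x \<rho>. norm (z - y) / 2 \<le> \<bar>(z - y) \<bullet> u\<bar>)"
proof -
  define A where "A = C / (1 - 2 powr (- \<beta>))"
  have "2 powr (- \<beta>) < 2 powr 0" using \<open>0 < \<beta>\<close> by (intro powr_less_mono) auto
  then have "0 \<le> A" using \<open>0 \<le> C\<close> by (simp add: A_def)
  have chain: "axis_dist (z - y) (w - y) \<le> A * (8 * \<rho>) powr \<beta>"
    if "y \<in> X" "z \<in> X" "w \<in> X" "y \<noteq> z" "norm (z - y) \<le> norm (w - y)" "norm (w - y) \<le> 8 * \<rho>" for y z w
  proof -
    have "axis_dist (z - y) (w - y) \<le> A * norm (w - y) powr \<beta>"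
      unfolding A_def
      by (rule axis_dist_chain[of X "8 * \<rho>", OF flat pts \<open>0 < \<beta>\<close> \<open>0 \<le> C\<close> that]) auto
    also have "\<dots> \<le> A * (8 * \<rho>) powr \<beta>"
      using \<open>0 \<le> A\<close> \<open>0 < \<beta>\<close> that by (intro mult_left_mono powr_mono2) auto
    finally show ?thesis .
  qed
  obtain p where p: "p \<in> X" "norm (p - x) = 4 * \<rho>" using pts[OF \<open>x \<in> X\<close>, of "4 * \<rho>"] \<open>0 < \<rho>\<close> by auto
  then have "p - x \<noteq> 0" using \<open>0 < \<rho>\<close> by auto
  have "norm (z - y) / 2 \<le> \<bar>(z - y) \<bullet> sgn (p - x)\<bar>"
    if yz: "y \<in> X \<inter> cball x \<rho>" "z \<in> X \<inter> cball x \<rho>" for y z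
  proof (cases "y = z")
    case False
    have d: "norm (y - x) \<le> \<rho>" "norm (z - x) \<le> \<rho>" using yz by (auto simp: dist_norm norm_minus_commute)
    have zy: "norm (z - y) \<le> 2 * \<rho>"
      using norm_triangle_ineq4[of "z - x" "y - x"] d by simp
    have py: "3 * \<rho> \<le> norm (p - y)" "norm (p - y) \<le> 5 * \<rho>"
      using norm_triangle_ineq[of "p - y" "y - x"] norm_triangle_ineq4[of "p - x" "y - x"] d p by simp_all
    have "axis_dist (z - y) (p - y) \<le> A * (8 * \<rho>) powr \<beta>"
      by (rule chain) (use yz p False zy py \<open>0 < \<rho>\<close> in auto)
    moreover have "axis_dist (p - y) (p - x) \<le> A * (8 * \<rho>) powr \<beta>"
    proof -
      have *: "axis_dist (p - y) (p - x) = axis_dist (y - p) (x - p)"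
        using axis_dist_minus[of "y - p" "x - p"] by simp
      have n: "norm (y - p) = norm (p - y)" "norm (x - p) = norm (p - x)" by (simp_all add: norm_minus_commute)
      have "p \<noteq> y" "p \<noteq> x" using py p \<open>0 < \<rho>\<close> by auto
      show ?thesis
      proof (cases "norm (y - p) \<le> norm (x - p)")
        case True
        show ?thesis unfolding *
          by (rule chain) (use True yz p \<open>p \<noteq> y\<close> \<open>x \<in> X\<close> n \<open>0 < \<rho>\<close> in auto)
      next
        case False
        show ?thesis unfolding * axis_dist_commute[of "y - p"]
          by (rule chain) (use False yz p py \<open>p \<noteq> x\<close> \<open>x \<in> X\<close> n \<open>0 < \<rho>\<close> in auto)
      qed
    qed
    ultimately have "axis_dist (z - y) (p - x) < 1"
      using axis_dist_triangle[of "z - y" "p - x" "p - y"] small by (simp add: A_def)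
    then show ?thesis using \<open>p - x \<noteq> 0\<close> by (rule inner_ge_of_axis_dist)
  qed simp
  moreover have "norm (sgn (p - x)) = 1" using \<open>p - x \<noteq> 0\<close> by (simp add: norm_sgn)
  ultimately show ?thesis by blast
qed

section \<open>Two strands in a ball\<close>

lemma last_exit:
  fixes h :: "real \<Rightarrow> real"
  assumes cont: "continuous_on {c..s} h" and "c \<le> s" and "h s \<le> \<rho>" "\<rho> \<le> h c"
  shows "\<exists>a\<in>{c..s}. h a = \<rho> \<and> (\<forall>r\<in>{a..s}. h r \<le> \<rho>)"
proof -
  define S where "S = {r \<in> {c..s}. h r = \<rho>}"
  have ivt: "\<exists>r'\<in>S. r \<le> r'" if "r \<in> {c..s}" "\<rho> \<le> h r" for r
  proof -
    have "\<exists>r'\<ge>r. r' \<le> s \<and> h r' = \<rho>"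
      by (rule IVT2') (use that \<open>h s \<le> \<rho>\<close> in \<open>auto intro: continuous_on_subset[OF cont]\<close>)
    then obtain r' where "r \<le> r'" "r' \<le> s" "h r' = \<rho>" by blast
    then show ?thesis using that by (intro bexI[of _ r']) (auto simp: S_def)
  qed
  have "closed S"
    using continuous_closed_preimage_constant[OF cont, of \<rho>] by (simp add: S_def)
  then have "compact S"
    by (metis (no_types, lifting) S_def bounded_closed_interval bounded_subset compact_eq_bounded_closed mem_Collect_eq subsetI)
  moreover have "S \<noteq> {}" using ivt[of c] assms by auto
  ultimately have "\<exists>a\<in>S. \<forall>r\<in>S. r \<le> a" by (rule compact_attains_sup)
  then obtain a where a: "a \<in> S" "\<And>r. r \<in> S \<Longrightarrow> r \<le> a" by blast
  have "h r \<le> \<rho>" if r: "r \<in> {a..s}" for r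
  proof (rule ccontr)
    assume "\<not> h r \<le> \<rho>"
    then obtain r' where "r' \<in> S" "r \<le> r'" using ivt[of r] r a(1) by (force simp: S_def)
    then have "r = a" using a(2) r by force
    then show False using \<open>\<not> h r \<le> \<rho>\<close> a(1) by (simp add: S_def)
  qed
  then show ?thesis using a(1) by (auto simp: S_def)
qed

lemma first_exit:
  fixes h :: "real \<Rightarrow> real"
  assumes cont: "continuous_on {s..c} h" and "s \<le> c" and "h s \<le> \<rho>" "\<rho> \<le> h c"
  shows "\<exists>b\<in>{s..c}. h b = \<rho> \<and> (\<forall>r\<in>{s..b}. h r \<le> \<rho>)"
proof -
  have "\<exists>a\<in>{- c..- s}. h (- a) = \<rho> \<and> (\<forall>r\<in>{a..- s}. h (- r) \<le> \<rho>)"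
    by (rule last_exit) (use assms in \<open>auto intro!: continuous_intros continuous_on_compose2[OF cont]\<close>)
  then obtain a where a: "a \<in> {- c..- s}" "h (- a) = \<rho>" "\<And>r. r \<in> {a..- s} \<Longrightarrow> h (- r) \<le> \<rho>" by blast
  have "h r \<le> \<rho>" if "r \<in> {s..- a}" for r using a(3)[of "- r"] that by auto
  then show ?thesis using a by (intro bexI[of _ "- a"]) auto
qed

lemma periodic_map_rmod:
  assumes "periodic_map L g"
  shows "g (x rmod L) = g x"
proof -
  have 1: "g (y + of_nat n * L) = g y" for y n
    using assms by (induction n arbitrary: y) (auto simp: periodic_map_def algebra_simps simp flip: add.assoc)
  have 2: "g (y + of_int k * L) = g y" for y k
  proof (cases "0 \<le> k")
    case True
    then show ?thesis using 1[of y "nat k"] by simp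
  next
    case False
    then show ?thesis using 1[of "y + of_int k * L" "nat (- k)"] by (simp add: algebra_simps)
  qed
  have "\<exists>k. x rmod L = x + of_int k * L"
  proof (cases "L \<ge> 0")
    case True
    then show ?thesis by (intro exI[of _ "- \<lfloor>x / \<bar>L\<bar>\<rfloor>"]) (simp add: rmod_def)
  next
    case False
    then show ?thesis by (intro exI[of _ "\<lfloor>x / \<bar>L\<bar>\<rfloor>"]) (simp add: rmod_def)
  qed
  then show ?thesis using 2 by metis
qed

lemma injective_closed_curve_eqD:
  assumes "injective_closed_curve L \<gamma>" "0 < L" "\<gamma> x = \<gamma> y" "\<bar>x - y\<bar> < L"
  shows "x = y"
proof -
  have per: "periodic_map L \<gamma>" and inj: "inj_on \<gamma> {0..<L}"
    using assms by (auto simp: injective_closed_curve_def closed_curve_def)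
  have "\<gamma> (x rmod L) = \<gamma> (y rmod L)" using assms(3) by (simp add: periodic_map_rmod[OF per])
  then have "x rmod L = y rmod L"
    by (rule inj_onD[OF inj]) (use \<open>0 < L\<close> in \<open>auto simp: rmod_nonneg rmod_less\<close>)
  then have "x - y = L * of_int (\<lfloor>x / L\<rfloor> - \<lfloor>y / L\<rfloor>)"
    using \<open>0 < L\<close> by (simp add: rmod_def algebra_simps)
  moreover from this have "\<bar>of_int (\<lfloor>x / L\<rfloor> - \<lfloor>y / L\<rfloor>) :: real\<bar> < 1"
    using assms(2,4) by (simp add: abs_mult)
  then have "\<lfloor>x / L\<rfloor> - \<lfloor>y / L\<rfloor> = 0" by linarith
  ultimately show ?thesis by simp
qed

text \<open>
  Let \<open>{a..b}\<close> be the parameter interval around \<open>s\<close> on which the curve stays in the ball. The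
  projection \<open>\<phi>\<close> to the direction \<open>u\<close> is continuous and injective on \<open>{a..b}\<close>, hence strictly
  monotone, and it has modulus at least \<open>\<rho> / 2\<close> at both ends, so it takes every value in between.
  If \<open>\<gamma> t\<close> were closer to \<open>\<gamma> s\<close> than \<open>\<rho> / 2\<close>, its projection would be taken at some \<open>c\<close> in
  \<open>{a..b}\<close> as well; as \<open>\<phi>\<close> separates the points of the curve in the ball, \<open>\<gamma> c = \<gamma> t\<close>, which
  contradicts injectivity.
\<close>

lemma strands_apart:
  fixes \<gamma> :: "real \<Rightarrow> real ^ 'n"
  assumes inj: "injective_closed_curve L \<gamma>" and "0 < L" "0 < \<rho>"
    and ord: "m < s" "s < m'" "m' < t" "t < m + L"
    and far: "\<rho> \<le> norm (\<gamma> m - \<gamma> s)" "\<rho> \<le> norm (\<gamma> m' - \<gamma> s)"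
    and graph: "\<And>y z. y \<in> range \<gamma> \<inter> cball (\<gamma> s) \<rho> \<Longrightarrow> z \<in> range \<gamma> \<inter> cball (\<gamma> s) \<rho> \<Longrightarrow>
        norm (z - y) / 2 \<le> \<bar>(z - y) \<bullet> u\<bar>" and "norm u = 1"
  shows "\<rho> / 2 \<le> norm (\<gamma> t - \<gamma> s)"
proof (rule ccontr)
  assume "\<not> ?thesis"
  then have close: "norm (\<gamma> t - \<gamma> s) < \<rho> / 2" by simp
  have cont: "continuous_on S \<gamma>" for S
    using inj by (auto simp: injective_closed_curve_def closed_curve_def intro: continuous_on_subset)
  define h where "h = (\<lambda>r. norm (\<gamma> r - \<gamma> s))"
  have cont_h: "continuous_on S h" for S unfolding h_def by (intro continuous_intros cont)
  obtain a where a: "a \<in> {m..s}" "h a = \<rho>" "\<And>r. r \<in> {a..s} \<Longrightarrow> h r \<le> \<rho>"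
    using last_exit[OF cont_h, of m s \<rho>] ord far \<open>0 < \<rho>\<close> by (auto simp: h_def)
  obtain b where b: "b \<in> {s..m'}" "h b = \<rho>" "\<And>r. r \<in> {s..b} \<Longrightarrow> h r \<le> \<rho>"
    using first_exit[OF cont_h, of s m' \<rho>] ord far \<open>0 < \<rho>\<close> by (auto simp: h_def)
  have "h s = 0" by (simp add: h_def)
  then have "a < s" "s < b" using a b \<open>0 < \<rho>\<close> by (auto simp: le_less)
  have in_ball: "\<gamma> r \<in> range \<gamma> \<inter> cball (\<gamma> s) \<rho>" if "r \<in> {a..b}" for r
    using a(3)[of r] b(3)[of r] that by (cases "r \<le> s") (auto simp: h_def dist_norm norm_minus_commute)
  have t_ball: "\<gamma> t \<in> range \<gamma> \<inter> cball (\<gamma> s) \<rho>"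
    using close \<open>0 < \<rho>\<close> by (auto simp: dist_norm norm_minus_commute)
  define \<phi> where "\<phi> = (\<lambda>r. (\<gamma> r - \<gamma> s) \<bullet> u)"
  have diff: "\<phi> r - \<phi> r' = (\<gamma> r - \<gamma> r') \<bullet> u" for r r' by (simp add: \<phi>_def inner_diff_left)
  have cont_\<phi>: "continuous_on S \<phi>" for S unfolding \<phi>_def by (intro continuous_intros cont)
  have eqD: "\<gamma> r = \<gamma> r'" if "\<gamma> r \<in> range \<gamma> \<inter> cball (\<gamma> s) \<rho>" "\<gamma> r' \<in> range \<gamma> \<inter> cball (\<gamma> s) \<rho>" "\<phi> r = \<phi> r'" for r r'
    using graph[OF that(2,1)] diff[of r r'] that(3) by simp
  have "inj_on \<phi> {a..b}"
  proof (rule inj_onI)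
    fix r r' assume r: "r \<in> {a..b}" "r' \<in> {a..b}" "\<phi> r = \<phi> r'"
    then have "\<gamma> r = \<gamma> r'" using eqD in_ball by blast
    then show "r = r'"
      by (rule injective_closed_curve_eqD[OF inj \<open>0 < L\<close>]) (use r a(1) b(1) ord in auto)
  qed
  then have mono: "(\<phi> a < \<phi> s \<and> \<phi> s < \<phi> b) \<or> (\<phi> b < \<phi> s \<and> \<phi> s < \<phi> a)"
    by (intro continuous_inj_imp_mono[OF \<open>a < s\<close> \<open>s < b\<close> cont_\<phi>])
  have "\<phi> s = 0" by (simp add: \<phi>_def)
  have "\<rho> / 2 \<le> \<bar>\<phi> a\<bar>"
    using graph[of "\<gamma> s" "\<gamma> a"] in_ball[of a] in_ball[of s] \<open>a < s\<close> \<open>s < b\<close> a(2) by (simp add: \<phi>_def h_def)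
  moreover have "\<rho> / 2 \<le> \<bar>\<phi> b\<bar>"
    using graph[of "\<gamma> s" "\<gamma> b"] in_ball[of b] in_ball[of s] \<open>a < s\<close> \<open>s < b\<close> b(2) by (simp add: \<phi>_def h_def)
  moreover have "\<bar>\<phi> t\<bar> < \<rho> / 2"
    using Cauchy_Schwarz_ineq2[of "\<gamma> t - \<gamma> s" u] \<open>norm u = 1\<close> close by (simp add: \<phi>_def)
  ultimately have "(\<phi> a \<le> \<phi> t \<and> \<phi> t \<le> \<phi> b) \<or> (\<phi> b \<le> \<phi> t \<and> \<phi> t \<le> \<phi> a)"
    using mono \<open>\<phi> s = 0\<close> by linarith
  then obtain c where c: "a \<le> c" "c \<le> b" "\<phi> c = \<phi> t"
    using IVT'[of \<phi> a "\<phi> t" b] IVT2'[of \<phi> b "\<phi> t" a] cont_\<phi> \<open>a < s\<close> \<open>s < b\<close> by fastforce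
  then have "\<gamma> c = \<gamma> t" using eqD in_ball t_ball by simp
  then have "c = t"
    by (rule injective_closed_curve_eqD[OF inj \<open>0 < L\<close>]) (use c a(1) b(1) ord in auto)
  then show False using c b(1) ord by simp
qed

section \<open>Bounded energy separates the strands\<close>

lemma AE_exists_in_interval:
  fixes a b :: real
  assumes "AE t in lborel. P t" "a < b"
  shows "\<exists>t\<in>{a<..<b}. P t"
proof (rule ccontr)
  assume "\<not> ?thesis"
  then have no: "P t \<Longrightarrow> t \<in> {a<..<b} \<longrightarrow> t \<in> {}" for t by blast
  have "AE t in lebesgue. t \<in> {a<..<b} \<longrightarrow> t \<in> {}"
    using AE_completion[OF assms(1)] by (rule eventually_mono) (rule no)
  moreover have "(a + b) / 2 \<in> {a<..<b}" using \<open>a < b\<close> by simp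
  ultimately have "(a + b) / 2 \<in> ({} :: real set)"
    by (rule mem_closed_if_AE_lebesgue_open[OF open_greaterThanLessThan closed_empty])
  then show False by simp
qed

text \<open>
  A constant piece would have derivative zero, but almost every parameter is a tangent point.
\<close>

lemma closed_arclength_curve_not_constant:
  fixes \<Gamma> :: "real \<Rightarrow> real ^ 'n"
  assumes "closed_arclength_curve L \<Gamma>" "a < b"
  shows "\<exists>t\<in>{a<..<b}. \<Gamma> t \<noteq> c"
proof (rule ccontr)
  assume const: "\<not> ?thesis"
  obtain t where t: "t \<in> {a<..<b}" "t \<in> tangent_pts \<Gamma>"
    using AE_exists_in_interval assms unfolding closed_arclength_curve_def by blast
  have "((\<lambda>_. c) has_vector_derivative 0) (at t)" by simp
  then have "(\<Gamma> has_vector_derivative 0) (at t)"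
    by (rule has_vector_derivative_transform_within_open[of _ _ _ "{a<..<b}"]) (use t const in auto)
  then show False using t(2) by (auto simp: tangent_pts_def dest: vector_derivative_at)
qed

text \<open>
  One of the two points that are \<open>2 * r\<close> apart is at least \<open>r\<close> away from \<open>\<gamma> c\<close>, and the image is
  connected.
\<close>

lemma point_at_distance:
  fixes \<gamma> :: "real \<Rightarrow> real ^ 'n"
  assumes cont: "continuous_on UNIV \<gamma>" and far: "2 * r \<le> norm (\<gamma> a - \<gamma> b)" and "0 \<le> r"
  shows "\<exists>p\<in>range \<gamma>. norm (p - \<gamma> c) = r"
proof -
  have "connected ((\<lambda>t. norm (\<gamma> t - \<gamma> c)) ` UNIV)"
    by (intro connected_continuous_image continuous_intros cont) simp
  moreover have "norm (\<gamma> c - \<gamma> c) \<in> (\<lambda>t. norm (\<gamma> t - \<gamma> c)) ` UNIV" by blast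
  moreover obtain e where "r \<le> norm (\<gamma> e - \<gamma> c)"
  proof -
    have "norm (\<gamma> a - \<gamma> b) \<le> norm (\<gamma> a - \<gamma> c) + norm (\<gamma> b - \<gamma> c)"
      using norm_triangle_ineq4[of "\<gamma> a - \<gamma> c" "\<gamma> b - \<gamma> c"] by simp
    then have "r \<le> norm (\<gamma> a - \<gamma> c) \<or> r \<le> norm (\<gamma> b - \<gamma> c)" using far by linarith
    then show thesis using that by blast
  qed
  ultimately have "{norm (\<gamma> c - \<gamma> c)..norm (\<gamma> e - \<gamma> c)} \<subseteq> (\<lambda>t. norm (\<gamma> t - \<gamma> c)) ` UNIV"
    by (intro connected_contains_Icc) auto
  moreover have "r \<in> {norm (\<gamma> c - \<gamma> c)..norm (\<gamma> e - \<gamma> c)}" using \<open>0 \<le> r\<close> \<open>r \<le> norm (\<gamma> e - \<gamma> c)\<close> by simp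
  ultimately show ?thesis by blast
qed

lemma range_periodic:
  assumes "periodic_map L \<gamma>" "0 < L"
  shows "range \<gamma> = \<gamma> ` {0..L}"
proof
  show "range \<gamma> \<subseteq> \<gamma> ` {0..L}"
  proof (rule image_subsetI)
    fix t
    have "\<gamma> (t rmod L) \<in> \<gamma> ` {0..L}"
      using \<open>0 < L\<close> by (intro imageI) (auto simp: rmod_nonneg rmod_le)
    then show "\<gamma> t \<in> \<gamma> ` {0..L}" by (simp add: periodic_map_rmod[OF assms(1)])
  qed
qed auto

text \<open>
  The parameters \<open>m'\<close> and \<open>m + L\<close> lie on the two arcs between \<open>\<gamma> s\<close> and \<open>\<gamma> t\<close> and witness that
  both arcs leave the ball around \<open>\<gamma> s\<close>. The arclength parametrization enters only through
  flatness of its image, which is the image of \<open>\<gamma>\<close>; the strands are compared in \<open>\<gamma>\<close> itself, whose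
  parameters are those of the uniform limit.
\<close>

lemma energy_separation:
  fixes \<gamma> :: "real \<Rightarrow> real ^ 'n"
  assumes "0 < L" and rect: "rectifiable_closed_curve L \<gamma>" and inj: "injective_closed_curve L \<gamma>"
    and energy: "tp_energy_of_curve q L \<gamma> \<le> ennreal M" and "0 \<le> M" "2 < q"
    and ord: "m < s" "s < m'" "m' < t" "t < m + L"
    and far: "8 * \<rho> \<le> norm (\<gamma> m - \<gamma> s)" "8 * \<rho> \<le> norm (\<gamma> m' - \<gamma> s)" and "0 < \<rho>"
  defines "\<beta> \<equiv> (q - 2) / (q + 2)" and "C \<equiv> 8 * (2 + 4 * (M + 1) powr (1 / q))"
  assumes small: "(8 * \<rho>) powr \<beta> \<le> 1 / 8" "2 * (C / (1 - 2 powr (- \<beta>))) * (8 * \<rho>) powr \<beta> < 1"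
  shows "\<rho> / 2 \<le> norm (\<gamma> t - \<gamma> s)"
proof -
  have per: "periodic_map L \<gamma>" and cont: "continuous_on UNIV \<gamma>"
    using inj by (auto simp: injective_closed_curve_def closed_curve_def)
  have "0 < \<beta>" using \<open>2 < q\<close> by (simp add: \<beta>_def)
  have "0 \<le> C" by (simp add: C_def)
  define l where "l = total_length L \<gamma>"
  define f where "f = arclength_parametrization L \<gamma>"
  note f = arclength_parametrization_properties[OF \<open>0 < L\<close> rect inj, folded l_def f_def]
  have X: "range \<gamma> = f ` {0..l}" using f(3) range_periodic[OF per \<open>0 < L\<close>] by simp
  have tang: "AE t in lborel. t \<in> {0..l} \<longrightarrow> t \<in> tangent_pts f" by (rule AE_tangent_pts[OF f(2,4)])
  have E: "tp_energy q l f \<le> ennreal M" using energy by (simp add: tp_energy_of_curve_def l_def f_def)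
  have flat: "axis_dist (z - y) (w - y) \<le> C * norm (w - y) powr \<beta>"
    if yzw: "y \<in> range \<gamma>" "z \<in> range \<gamma>" "w \<in> range \<gamma>" "y \<noteq> z" "norm (z - y) \<le> norm (w - y)"
      "norm (w - y) \<le> 2 * norm (z - y)" "norm (w - y) \<le> 8 * \<rho>" for y z w
  proof -
    have "norm (w - y) powr \<beta> \<le> (8 * \<rho>) powr \<beta>" using yzw \<open>0 < \<beta>\<close> by (intro powr_mono2) auto
    then have "norm (w - y) powr \<beta> \<le> 1 / 8" using small(1) by linarith
    then show ?thesis
      unfolding C_def \<beta>_def
      by (intro energy_flatness[OF f(2) tang E \<open>0 \<le> M\<close> \<open>2 < q\<close>]) (use yzw in \<open>auto simp: X\<close>)
  qed
  have pts: "\<exists>p\<in>range \<gamma>. norm (p - y) = r" if "y \<in> range \<gamma>" "0 < r" "r \<le> 4 * \<rho>" for y r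
  proof -
    obtain c where "y = \<gamma> c" using \<open>y \<in> range \<gamma>\<close> by blast
    moreover have "2 * r \<le> norm (\<gamma> m - \<gamma> s)" using that far by linarith
    ultimately show ?thesis using point_at_distance[OF cont] \<open>0 < r\<close> by auto
  qed
  obtain u where u: "norm u = 1" "\<And>y z. y \<in> range \<gamma> \<inter> cball (\<gamma> s) \<rho> \<Longrightarrow>
      z \<in> range \<gamma> \<inter> cball (\<gamma> s) \<rho> \<Longrightarrow> norm (z - y) / 2 \<le> \<bar>(z - y) \<bullet> u\<bar>"
    using lipschitz_graph[of "range \<gamma>" \<rho> C \<beta> "\<gamma> s", OF flat pts \<open>0 < \<beta>\<close> \<open>0 \<le> C\<close> \<open>0 < \<rho>\<close> small(2)] by blast
  show ?thesis
    by (rule strands_apart[OF inj \<open>0 < L\<close> \<open>0 < \<rho>\<close> ord _ _ u(2,1)]) (use far \<open>0 < \<rho>\<close> in auto)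
qed

text \<open>
  Supplies a scale \<open>\<rho>\<close> that depends only on the energy bound and the exponent, through \<open>B\<close> and
  \<open>\<beta>\<close>, and on the size \<open>d\<close> of the arcs.
\<close>

lemma small_scale_exists:
  fixes d \<beta> B :: real
  assumes "0 < d" "0 < \<beta>" "0 \<le> B"
  shows "\<exists>\<rho>>0. 8 * \<rho> \<le> d \<and> (8 * \<rho>) powr \<beta> \<le> 1 / 8 \<and> B * (8 * \<rho>) powr \<beta> < 1"
proof -
  define \<kappa> where "\<kappa> = 1 / (8 * (B + 1))"
  have \<kappa>: "0 < \<kappa>" "\<kappa> \<le> 1 / 8" "B * \<kappa> < 1" using \<open>0 \<le> B\<close> by (auto simp: \<kappa>_def field_simps)
  define \<rho> where "\<rho> = min d (\<kappa> powr (1 / \<beta>)) / 8"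
  have "0 < \<rho>" using \<open>0 < d\<close> \<kappa> by (simp add: \<rho>_def)
  have "(8 * \<rho>) powr \<beta> \<le> (\<kappa> powr (1 / \<beta>)) powr \<beta>"
    using assms \<open>0 < \<rho>\<close> by (intro powr_mono2) (auto simp: \<rho>_def)
  also have "\<dots> = \<kappa>" using \<open>0 < \<beta>\<close> \<kappa> by (simp add: powr_powr)
  finally have le: "(8 * \<rho>) powr \<beta> \<le> \<kappa>" .
  then have "B * (8 * \<rho>) powr \<beta> \<le> B * \<kappa>" using \<open>0 \<le> B\<close> by (intro mult_left_mono)
  then show ?thesis using le \<kappa> \<open>0 < \<rho>\<close> by (intro exI[of _ \<rho>]) (auto simp: \<rho>_def)
qed

theorem proposition5p1:
  fixes L q :: real
    and \<Gamma> :: "real \<Rightarrow> real ^ 'n"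
    and \<gamma> :: "nat \<Rightarrow> real \<Rightarrow> real ^ 'n"
  assumes "0 < L"
    and "closed_arclength_curve L \<Gamma>"
    and "\<exists>s\<in>{0..<L}. \<exists>t\<in>{0..<L}. s \<noteq> t \<and> \<Gamma> s = \<Gamma> t"
    and "\<And>k. rectifiable_closed_curve L (\<gamma> k)"
    and "\<And>k. injective_closed_curve L (\<gamma> k)"
    and "uniform_limit UNIV \<gamma> \<Gamma> sequentially"
    and "q > 2"
  shows "(\<lambda>k. tp_energy_of_curve q L (\<gamma> k)) \<longlonglongrightarrow> \<infinity>"
proof -
  obtain s t where st: "0 \<le> s" "s < t" "t < L" "\<Gamma> s = \<Gamma> t"
  proof -
    obtain s t where "s \<in> {0..<L}" "t \<in> {0..<L}" "s \<noteq> t" "\<Gamma> s = \<Gamma> t" using assms(3) by blast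
    then show thesis using that[of s t] that[of t s] by (cases "s < t") auto
  qed
  have "t - L < s" using st by simp
  then obtain m where m: "m \<in> {t - L<..<s}" "\<Gamma> m \<noteq> \<Gamma> s"
    using closed_arclength_curve_not_constant[OF assms(2)] by blast
  obtain m' where m': "m' \<in> {s<..<t}" "\<Gamma> m' \<noteq> \<Gamma> s"
    using closed_arclength_curve_not_constant[OF assms(2) st(2)] by blast
  \<comment> \<open>Half of the distances that \<open>\<Gamma>\<close> attains, so that they survive the approximation.\<close>
  define d where "d = min (norm (\<Gamma> m - \<Gamma> s)) (norm (\<Gamma> m' - \<Gamma> s)) / 2"
  have "0 < d" using m m' by (simp add: d_def)
  have "eventually (\<lambda>k. ennreal M < tp_energy_of_curve q L (\<gamma> k)) sequentially" if "0 \<le> M" for M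
  proof -
    define \<beta> where "\<beta> = (q - 2) / (q + 2)"
    define C where "C = 8 * (2 + 4 * (M + 1) powr (1 / q))"
    have "0 < \<beta>" using \<open>q > 2\<close> by (simp add: \<beta>_def)
    then have "2 powr (- \<beta>) < 2 powr (0 :: real)" by (intro powr_less_mono) auto
    then have "0 \<le> 2 * (C / (1 - 2 powr (- \<beta>)))" by (simp add: C_def)
    then obtain \<rho> where \<rho>: "0 < \<rho>" "8 * \<rho> \<le> d" "(8 * \<rho>) powr \<beta> \<le> 1 / 8"
      "2 * (C / (1 - 2 powr (- \<beta>))) * (8 * \<rho>) powr \<beta> < 1"
      using small_scale_exists[OF \<open>0 < d\<close> \<open>0 < \<beta>\<close>] by blast
    have "0 < \<rho> / 4" using \<rho> by simp
    with assms(6) have "\<forall>\<^sub>F k in sequentially. \<forall>x\<in>UNIV. dist (\<gamma> k x) (\<Gamma> x) < \<rho> / 4"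
      by (rule uniform_limitD)
    then show ?thesis
    proof eventually_elim
      case (elim k)
      then have close: "norm (\<gamma> k x - \<Gamma> x) < \<rho> / 4" for x by (simp add: dist_norm)
      have diff: "norm ((\<gamma> k x - \<gamma> k y) - (\<Gamma> x - \<Gamma> y)) < \<rho> / 2" for x y
        using norm_triangle_ineq4[of "\<gamma> k x - \<Gamma> x" "\<gamma> k y - \<Gamma> y"] close[of x] close[of y]
        by (simp add: algebra_simps)
      show ?case
      proof (rule ccontr)
        assume "\<not> ?case"
        then have energy: "tp_energy_of_curve q L (\<gamma> k) \<le> ennreal M" by simp
        have far: "8 * \<rho> \<le> norm (\<gamma> k x - \<gamma> k s)" if "2 * d \<le> norm (\<Gamma> x - \<Gamma> s)" for x
          using that diff[of x s] norm_triangle_ineq3[of "\<gamma> k x - \<gamma> k s" "\<Gamma> x - \<Gamma> s"] \<rho>(1,2) by linarith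
        have "\<rho> / 2 \<le> norm (\<gamma> k t - \<gamma> k s)"
          by (rule energy_separation[OF \<open>0 < L\<close> assms(4,5) energy \<open>0 \<le> M\<close> \<open>q > 2\<close>,
                where m = m and m' = m'])
             (use m m' st \<rho> far[of m] far[of m'] in \<open>auto simp: d_def \<beta>_def C_def\<close>)
        then show False using diff[of t s] st(4) by simp
      qed
    qed
  qed
  then show ?thesis
    unfolding infinity_ennreal_def tendsto_top_iff_ennreal by blast
qed

end
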